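(* Let $\ell\ge 3$. A partition is an $(\ell,0)$-JM partition if and only if it is a generalized $\ell$-partition.
   Context: $(x,y)$ denotes the box in row $x$ and column $y$ of a Young diagram. The hook length $h^\lambda_{(a,b)}$ is the number of boxes of $\lambda$ to the right of and below $(a,b)$ (same row or same column), including $(a,b)$. A partition $\lambda$ is an $(\ell,0)$-JM partition if there do not exist boxes $(a,b),(a,y),(x,b)$ in the Young diagram of $\lambda$ with $\ell\mid h^\lambda_{(a,b)}$, $\ell\nmid h^\lambda_{(a,y)}$ and $\ell\nmid h^\lambda_{(x,b)}$. A removable $\ell$-rim hook (for short, $\ell$-rim hook) of $\lambda$ is a connected sequence of $\ell$ boxes of the Young diagram of $\lambda$, containing no $2\times2$ square, whose removal from $\lambda$ leaves the Young diagram of a partition. It is horizontal (vertical) if it is contained in a single row (column). Two rim hooks are adjacent if there are boxes, one in each, which share an edge. A partition $\lambda$ is a generalized $\ell$-partition if: (1) it has no removable $\ell$-rim hooks other than horizontal and vertical ones; (2) if $R$ is a vertical (resp. horizontal) $\ell$-rim hook of $\lambda$ and $S$ is a horizontal (resp. vertical) $\ell$-rim hook of $\lambda\setminus R$, then $R$ and $S$ are not adjacent; (3) after removing any sequence of horizontal and vertical $\ell$-rim hooks from $\lambda$, the remaining partition satisfies (1) and (2). *)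

theory Defs
  imports Main
begin

definition is_partition :: "nat list \<Rightarrow> bool" where
  "is_partition lam \<longleftrightarrow> sorted_wrt (\<ge>) lam \<and> 0 \<notin> set lam"

text \<open>Rows and columns are counted from 0, so the first box is \<open>(0, 0)\<close>. None of the notions
  below depends on this shift of the usual numbering.\<close>

definition young_diagram :: "nat list \<Rightarrow> (nat \<times> nat) set" where
  "young_diagram lam = {(x, y). x < length lam \<and> y < lam ! x}"

definition hook_length :: "nat list \<Rightarrow> nat \<times> nat \<Rightarrow> nat" where
  "hook_length lam = (\<lambda>(a, b).
     card {(x, y) \<in> young_diagram lam. (x = a \<and> b \<le> y) \<or> (y = b \<and> a \<le> x)})"

definition JM_partition :: "nat \<Rightarrow> nat list \<Rightarrow> bool" where
  "JM_partition l lam \<longleftrightarrow> is_partition lam \<and>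
     \<not> (\<exists>a b x y. (a, b) \<in> young_diagram lam \<and> (a, y) \<in> young_diagram lam \<and>
          (x, b) \<in> young_diagram lam \<and>
          l dvd hook_length lam (a, b) \<and>
          \<not> l dvd hook_length lam (a, y) \<and>
          \<not> l dvd hook_length lam (x, b))"

definition share_edge :: "nat \<times> nat \<Rightarrow> nat \<times> nat \<Rightarrow> bool" where
  "share_edge = (\<lambda>(x, y) (x', y').
     (x = x' \<and> (y' = Suc y \<or> y = Suc y')) \<or> (y = y' \<and> (x' = Suc x \<or> x = Suc x')))"

definition connected_boxes :: "(nat \<times> nat) set \<Rightarrow> bool" where
  "connected_boxes R \<longleftrightarrow>
     (\<forall>p\<in>R. \<forall>q\<in>R. (\<lambda>u v. u \<in> R \<and> v \<in> R \<and> share_edge u v)\<^sup>*\<^sup>* p q)"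

definition contains_square :: "(nat \<times> nat) set \<Rightarrow> bool" where
  "contains_square R \<longleftrightarrow>
     (\<exists>x y. {(x, y), (Suc x, y), (x, Suc y), (Suc x, Suc y)} \<subseteq> R)"

text \<open>\<open>removes_rim_hook l lam R mu\<close>: the set \<open>R\<close> is a removable \<open>l\<close>-rim hook of \<open>lam\<close>, and \<open>mu\<close>
  is the partition left after its removal. As a partition is determined by its diagram, \<open>mu\<close> is
  unique given \<open>lam\<close> and \<open>R\<close>.\<close>

definition removes_rim_hook ::
    "nat \<Rightarrow> nat list \<Rightarrow> (nat \<times> nat) set \<Rightarrow> nat list \<Rightarrow> bool" where
  "removes_rim_hook l lam R mu \<longleftrightarrow>
     R \<subseteq> young_diagram lam \<and> card R = l \<and> connected_boxes R \<and> \<not> contains_square R \<and>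
     is_partition mu \<and> young_diagram mu = young_diagram lam - R"

definition rim_hook :: "nat \<Rightarrow> nat list \<Rightarrow> (nat \<times> nat) set \<Rightarrow> bool" where
  "rim_hook l lam R \<longleftrightarrow> (\<exists>mu. removes_rim_hook l lam R mu)"

definition horizontal :: "(nat \<times> nat) set \<Rightarrow> bool" where
  "horizontal R \<longleftrightarrow> (\<exists>i. \<forall>(x, y)\<in>R. x = i)"

definition vertical :: "(nat \<times> nat) set \<Rightarrow> bool" where
  "vertical R \<longleftrightarrow> (\<exists>j. \<forall>(x, y)\<in>R. y = j)"

definition adjacent :: "(nat \<times> nat) set \<Rightarrow> (nat \<times> nat) set \<Rightarrow> bool" where
  "adjacent R S \<longleftrightarrow> (\<exists>u\<in>R. \<exists>v\<in>S. share_edge u v)"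

definition only_straight_hooks :: "nat \<Rightarrow> nat list \<Rightarrow> bool" where
  "only_straight_hooks l lam \<longleftrightarrow>
     (\<forall>R. rim_hook l lam R \<longrightarrow> horizontal R \<or> vertical R)"

definition no_adjacent_hooks :: "nat \<Rightarrow> nat list \<Rightarrow> bool" where
  "no_adjacent_hooks l lam \<longleftrightarrow>
     (\<forall>R mu S. removes_rim_hook l lam R mu \<longrightarrow> rim_hook l mu S \<longrightarrow>
        (vertical R \<and> horizontal S) \<or> (horizontal R \<and> vertical S) \<longrightarrow> \<not> adjacent R S)"

definition straight_step :: "nat \<Rightarrow> nat list \<Rightarrow> nat list \<Rightarrow> bool" where
  "straight_step l lam mu \<longleftrightarrow>
     (\<exists>R. removes_rim_hook l lam R mu \<and> (horizontal R \<or> vertical R))"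

definition generalized_partition :: "nat \<Rightarrow> nat list \<Rightarrow> bool" where
  "generalized_partition l lam \<longleftrightarrow> is_partition lam \<and>
     only_straight_hooks l lam \<and>
     no_adjacent_hooks l lam \<and>
     (\<forall>mu. (straight_step l)\<^sup>*\<^sup>* lam mu \<longrightarrow>
        only_straight_hooks l mu \<and> no_adjacent_hooks l mu)"

end

theory Submission
  imports Defs
begin

text \<open>
  Encode \<open>\<lambda>\<close> by its beads \<open>\<lambda>\<^sub>i - i - 1\<close>; the remaining integers are the gaps \<open>j - \<lambda>'\<^sub>j\<close>. The box \<open>(i, j)\<close>
  lies in the diagram iff gap \<open>j\<close> is below bead \<open>i\<close>, and its hook length is then their difference.
  Removing an \<open>l\<close>-rim hook moves a bead \<open>b\<close> to the gap \<open>b - l\<close>; the hook is horizontal (vertical) iff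
  the open window between \<open>b - l\<close> and \<open>b\<close> has only gaps (only beads), and two successive hooks of
  opposite type, given by \<open>b\<close> and \<open>c\<close>, are adjacent iff \<open>c = b + l\<close> or \<open>c = b - l\<close>.

  The JM condition says that for a bead \<open>b\<close> above a gap \<open>g\<close> on the same runner modulo \<open>l\<close>, either all
  gaps below \<open>b\<close> or all beads above \<open>g\<close> lie on that runner. It is invariant under moves, and it rules
  out mixed windows and consecutive windows of opposite type. Conversely, if no sequence of moves
  produces either, then all windows of the runner between \<open>g\<close> and \<open>b\<close> are full or all are empty; in
  the full case a gap below \<open>g\<close> on another runner leads to a mixed window, and the empty case is the
  full case for the reversed and complemented bead set.
\<close>

section \<open>Bead sets\<close>

definition abacus_move :: "int \<Rightarrow> int set \<Rightarrow> int \<Rightarrow> int set" where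
  "abacus_move l B b = insert (b - l) (B - {b})"

definition full_window :: "int set \<Rightarrow> int \<Rightarrow> int \<Rightarrow> bool" where
  "full_window B a b \<longleftrightarrow> (\<forall>t. a < t \<longrightarrow> t < b \<longrightarrow> t \<in> B)"

definition empty_window :: "int set \<Rightarrow> int \<Rightarrow> int \<Rightarrow> bool" where
  "empty_window B a b \<longleftrightarrow> (\<forall>t. a < t \<longrightarrow> t < b \<longrightarrow> t \<notin> B)"

text \<open>The forbidden pattern in contrapositive form: \<open>b\<close> and \<open>g\<close> are
  row and column of the corner box, \<open>g'\<close> is another column met by that row,
  \<open>b'\<close> another row met by that column.\<close>

definition JM_abacus :: "int \<Rightarrow> int set \<Rightarrow> bool" where
  "JM_abacus l B \<longleftrightarrow>
     (\<forall>b g. b \<in> B \<longrightarrow> g \<notin> B \<longrightarrow> g < b \<longrightarrow> l dvd b - g \<longrightarrow>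
        (\<forall>g'. g' \<notin> B \<longrightarrow> g' < b \<longrightarrow> l dvd b - g') \<or>
        (\<forall>b'. b' \<in> B \<longrightarrow> g < b' \<longrightarrow> l dvd b' - g))"

section \<open>The JM condition under moves and its effect on windows\<close>

lemma mem_abacus_move:
  "t \<in> abacus_move l B b \<longleftrightarrow> t = b - l \<or> t \<in> B \<and> t \<noteq> b"
  by (auto simp: abacus_move_def)

lemma JM_abacusD:
  assumes "JM_abacus l B" "b \<in> B" "g \<notin> B" "g < b" "l dvd b - g"
  shows "(\<forall>g'. g' \<notin> B \<longrightarrow> g' < b \<longrightarrow> l dvd b - g') \<or> (\<forall>b'. b' \<in> B \<longrightarrow> g < b' \<longrightarrow> l dvd b' - g)"
  using assms unfolding JM_abacus_def by blast

lemma dvd_shift: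
  fixes l :: int
  assumes "l dvd b - c"
  shows "l dvd c - a \<longleftrightarrow> l dvd b - a" "l dvd a - c \<longleftrightarrow> l dvd a - b"
proof -
  have "b - a = (b - c) + (c - a)" "a - c = (b - c) + (a - b)" by simp_all
  then show "l dvd c - a \<longleftrightarrow> l dvd b - a" "l dvd a - c \<longleftrightarrow> l dvd a - b"
    using assms by (metis dvd_add_right_iff)+
qed

text \<open>A pair \<open>c\<close>, \<open>g\<close> after the move is compared with an old pair
  \<open>c0\<close>, \<open>g0\<close> on the same runner, at least as far apart. Only the runner of
  \<open>b\<close> is affected, so on any other runner the two pairs coincide.\<close>

lemma JM_abacus_move:
  assumes l: "0 < l" and JM: "JM_abacus l B" and b: "b \<in> B" "b - l \<notin> B"
  shows "JM_abacus l (abacus_move l B b)"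
  unfolding JM_abacus_def
proof (intro allI impI)
  fix c g
  assume c: "c \<in> abacus_move l B b" and g: "g \<notin> abacus_move l B b" and gc: "g < c" "l dvd c - g"
  obtain c0 where c0: "c0 \<in> B" "c \<le> c0" "l dvd c0 - c" and c0_same: "\<not> l dvd c - b \<Longrightarrow> c0 = c"
  proof (cases "c = b - l")
    case True
    then show thesis using that[of b] b l by simp
  next
    case False
    then show thesis using that[of c] c by (simp add: mem_abacus_move)
  qed
  obtain g0 where g0: "g0 \<notin> B" "g0 \<le> g" "l dvd g - g0" and g0_same: "\<not> l dvd g - b \<Longrightarrow> g0 = g"
  proof (cases "g = b")
    case True
    then show thesis using that[of "b - l"] b l by simp
  next
    case False
    then show thesis using that[of g] g by (simp add: mem_abacus_move)
  qed
  have same: "c0 = c \<and> g0 = g" if "\<not> l dvd c - b"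
    using that c0_same g0_same dvd_shift(1)[OF gc(2), of b] by simp
  have c0g: "l dvd c0 - g" using dvd_add[OF c0(3) gc(2)] by simp
  have dv: "l dvd c0 - g0" using dvd_add[OF c0g g0(3)] by simp
  have "g0 < c0" using c0 g0 gc by linarith
  from JM_abacusD[OF JM c0(1) g0(1) this dv]
  show "(\<forall>g'. g' \<notin> abacus_move l B b \<longrightarrow> g' < c \<longrightarrow> l dvd c - g') \<or>
        (\<forall>b'. b' \<in> abacus_move l B b \<longrightarrow> g < b' \<longrightarrow> l dvd b' - g)"
  proof
    assume *: "\<forall>g'. g' \<notin> B \<longrightarrow> g' < c0 \<longrightarrow> l dvd c0 - g'"
    have "l dvd c - g'" if g': "g' \<notin> abacus_move l B b" "g' < c" for g'
    \<comment> \<open>Only \<open>b\<close> is a new gap. If it is off the runner of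
      \<open>c\<close>, the old gap \<open>b - l\<close> on its runner is below \<open>c\<close> too
      and contradicts \<open>*\<close>.\<close>
    proof (cases "g' = b")
      case True
      then show ?thesis
      proof (cases "l dvd c - b")
        case False
        then have "l dvd c - (b - l)" using * same b g' True l by auto
        then have "l dvd (c - b) + l" by (simp add: algebra_simps)
        with False show ?thesis by simp
      qed simp
    next
      case False
      then have "l dvd c0 - g'" using * g' c0 by (auto simp: mem_abacus_move)
      then show ?thesis using dvd_shift(1)[OF c0(3)] by blast
    qed
    then show ?thesis by blast
  next
    assume *: "\<forall>b'. b' \<in> B \<longrightarrow> g0 < b' \<longrightarrow> l dvd b' - g0"
    have "l dvd b' - g" if b': "b' \<in> abacus_move l B b" "g < b'" for b'
    proof (cases "b' = b - l")
      case True
      show ?thesis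
      proof (cases "l dvd c - b")
        case False
        then have "l dvd b - g" using * same b b' True l by auto
        then have "l dvd (b - g) - l" by simp
        moreover have "(b - g) - l = b' - g" using True by simp
        ultimately show ?thesis by metis
      next
        case 2: True
        have "l dvd (c - g) - (c - b) - l" by (intro dvd_diff gc(2) 2) simp
        moreover have "(c - g) - (c - b) - l = b' - g" using True by simp
        ultimately show ?thesis by metis
      qed
    next
      case False
      then have "l dvd b' - g0" using * b' g0 by (auto simp: mem_abacus_move)
      then show ?thesis using dvd_shift(2)[OF g0(3)] by blast
    qed
    then show ?thesis by blast
  qed
qed

text \<open>No position strictly between \<open>b - l\<close> and \<open>b\<close> lies on their
  runner. For this pair the two alternatives of the JM condition thus leave no gap or no bead in the
  window.\<close>

lemma JM_abacus_straight:
  assumes l: "0 < l" and JM: "JM_abacus l B" and b: "b \<in> B" "b - l \<notin> B"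
  shows "full_window B (b - l) b \<or> empty_window B (b - l) b"
proof -
  have nd: "\<not> l dvd b - t" "\<not> l dvd t - (b - l)" if "b - l < t" "t < b" for t
    using that zdvd_not_zless[of "b - t" l] zdvd_not_zless[of "t - (b - l)" l] by auto
  from JM_abacusD[OF JM b] l show ?thesis
    unfolding full_window_def empty_window_def using nd by auto
qed

text \<open>For the pair \<open>x + 2 * l\<close>, \<open>x\<close> either alternative makes
  \<open>x + 1\<close> and \<open>x + l + 1\<close>, which are off the runner and interior to the
  two windows, both beads or both gaps.\<close>

lemma JM_abacus_not_opposite:
  assumes l: "2 \<le> l" and JM: "JM_abacus l B" and x: "x \<notin> B" "x + 2 * l \<in> B"
  shows "\<not> (full_window B x (x + l) \<and> empty_window B (x + l) (x + 2 * l))"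
    "\<not> (empty_window B x (x + l) \<and> full_window B (x + l) (x + 2 * l))"
proof -
  have nd: "\<not> l dvd 1" "\<not> l dvd l - 1" "\<not> l dvd l + 1" "\<not> l dvd 2 * l - 1"
    using l zdvd_not_zless[of 1 l] zdvd_not_zless[of "l - 1" l]
      dvd_add_right_iff[of l l 1] dvd_add_right_iff[of l l "l - 1"] by auto
  have "(\<forall>g'. g' \<notin> B \<longrightarrow> g' < x + 2 * l \<longrightarrow> l dvd x + 2 * l - g') \<or>
        (\<forall>b'. b' \<in> B \<longrightarrow> x < b' \<longrightarrow> l dvd b' - x)"
    using JM_abacusD[OF JM x(2,1)] l by simp
  then have "x + 1 \<in> B \<and> x + l + 1 \<in> B \<or> x + 1 \<notin> B \<and> x + l + 1 \<notin> B"
  proof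
    assume *: "\<forall>g'. g' \<notin> B \<longrightarrow> g' < x + 2 * l \<longrightarrow> l dvd x + 2 * l - g'"
    show ?thesis using *[rule_format, of "x + 1"] *[rule_format, of "x + l + 1"] l nd by auto
  next
    assume *: "\<forall>b'. b' \<in> B \<longrightarrow> x < b' \<longrightarrow> l dvd b' - x"
    show ?thesis using *[rule_format, of "x + 1"] *[rule_format, of "x + l + 1"] l nd by auto
  qed
  then show "\<not> (full_window B x (x + l) \<and> empty_window B (x + l) (x + 2 * l))"
    "\<not> (empty_window B x (x + l) \<and> full_window B (x + l) (x + 2 * l))"
    unfolding full_window_def empty_window_def using l
    by (metis add_less_cancel_left add.assoc less_add_one mult_2 less_le_trans one_less_numeral_iff
        semiring_norm(76))+
qed

section \<open>Duality of bead sets\<close>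

text \<open>Up to a shift by one this is passage to the conjugate partition: the negated gaps become
  beads.\<close>

definition dual :: "int set \<Rightarrow> int set" where
  "dual B = {t. - t \<notin> B}"

lemma mem_dual: "t \<in> dual B \<longleftrightarrow> - t \<notin> B"
  by (simp add: dual_def)

lemma dual_dual: "dual (dual B) = B"
  by (simp add: dual_def)

text \<open>The move shifts a gap from \<open>b - l\<close> up to \<open>b\<close>; after negation a
  bead goes from \<open>l - b\<close> down to \<open>- b\<close>.\<close>

lemma dual_abacus_move:
  assumes "0 < l" "b \<in> B" "b - l \<notin> B"
  shows "dual (abacus_move l B b) = abacus_move l (dual B) (l - b)"
  using assms by (auto simp: mem_dual mem_abacus_move minus_equation_iff)

lemma window_dual:
  "full_window (dual B) a b \<longleftrightarrow> empty_window B (- b) (- a)"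
  "empty_window (dual B) a b \<longleftrightarrow> full_window B (- b) (- a)"
  unfolding full_window_def empty_window_def mem_dual
  by (metis minus_less_iff less_minus_iff minus_minus)+

text \<open>The hypotheses below are what conditions (1), (2) and (3) on a generalized partition say about
  bead sets; \<open>P\<close> stands for the bead sets reachable from the given one.\<close>

locale straight_abaci =
  fixes l :: int and P :: "int set \<Rightarrow> bool"
  assumes l_ge_3: "3 \<le> l"
    and move: "\<lbrakk>P B; b \<in> B; b - l \<notin> B\<rbrakk> \<Longrightarrow> P (abacus_move l B b)"
    and straight: "\<lbrakk>P B; b \<in> B; b - l \<notin> B\<rbrakk> \<Longrightarrow> full_window B (b - l) b \<or> empty_window B (b - l) b"
    and not_full_empty: "\<lbrakk>P B; x \<notin> B; x + 2 * l \<in> B\<rbrakk> \<Longrightarrow>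
      \<not> (full_window B x (x + l) \<and> empty_window B (x + l) (x + 2 * l))"
    and not_empty_full: "\<lbrakk>P B; x \<notin> B; x + 2 * l \<in> B\<rbrakk> \<Longrightarrow>
      \<not> (empty_window B x (x + l) \<and> full_window B (x + l) (x + 2 * l))"
begin

text \<open>If \<open>g\<close> is a gap and \<open>g + k l\<close> a bead, moves on this runner alone bring a gap to \<open>g + i l\<close> and a
  bead to \<open>g + j l\<close>. As the other runners are untouched, the conditions on windows at these
  positions can then be read in the original bead set.\<close>

lemma squeeze:
  assumes "P B" "g \<notin> B" "g + int k * l \<in> B" "i < j" "j \<le> k"
  shows "\<exists>B'. P B' \<and> g + int i * l \<notin> B' \<and> g + int j * l \<in> B' \<and>
    (\<forall>t. \<not> l dvd t - g \<longrightarrow> (t \<in> B' \<longleftrightarrow> t \<in> B))"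
  using assms
proof (induction k arbitrary: B g i j)
  case 0
  then show ?case by simp
next
  case (Suc k)
  have l: "0 < l" using l_ge_3 by simp
  consider "i = 0" "j = Suc k" | "0 < i" | "i = 0" "j \<le> k" using Suc.prems by linarith
  then show ?case
  proof cases
    case 1
    then show ?thesis using Suc.prems by auto
  next
    \<comment> \<open>Shortening from below: if \<open>g + l\<close> is a bead, it moves to
      \<open>g\<close> and leaves a gap. The induction continues from \<open>g + l\<close> with both
      indices lowered by one.\<close>
    case 2
    then have kpos: "0 < k" using Suc.prems by linarith
    have "\<exists>B0. P B0 \<and> g + l \<notin> B0 \<and> g + int (Suc k) * l \<in> B0 \<and>
        (\<forall>t. \<not> l dvd t - g \<longrightarrow> (t \<in> B0 \<longleftrightarrow> t \<in> B))"
    proof (cases "g + l \<in> B")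
      case True
      show ?thesis
      proof (intro exI[of _ "abacus_move l B (g + l)"] conjI allI impI)
        show "P (abacus_move l B (g + l))" using move[OF Suc.prems(1) True] Suc.prems(2) by simp
      qed (use True Suc.prems l kpos in \<open>auto simp: mem_abacus_move algebra_simps\<close>)
    next
      case False
      then show ?thesis using Suc.prems by blast
    qed
    then obtain B0 where B0: "P B0" "g + l \<notin> B0" "g + int (Suc k) * l \<in> B0"
      "\<And>t. \<not> l dvd t - g \<Longrightarrow> t \<in> B0 \<longleftrightarrow> t \<in> B" by blast
    have "g + l + int k * l \<in> B0" using B0(3) by (simp add: algebra_simps)
    have ij: "i - 1 < j - 1" "j - 1 \<le> k" using 2 Suc.prems by linarith+
    from Suc.IH[OF B0(1,2) \<open>g + l + int k * l \<in> B0\<close> ij]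
    obtain B' where B': "P B'" "g + l + int (i - 1) * l \<notin> B'" "g + l + int (j - 1) * l \<in> B'"
      "\<And>t. \<not> l dvd t - (g + l) \<Longrightarrow> t \<in> B' \<longleftrightarrow> t \<in> B0" by blast
    have "g + l + int (i - 1) * l = g + int i * l" "g + l + int (j - 1) * l = g + int j * l"
      using 2 Suc.prems by (simp_all add: of_nat_diff algebra_simps)
    moreover have "l dvd t - (g + l) \<longleftrightarrow> l dvd t - g" for t
      using dvd_diff_left_iff[of l l "t - g"] by (simp add: algebra_simps)
    ultimately show ?thesis using B' B0 by metis
  next
    \<comment> \<open>Shortening from above: if \<open>g + int k * l\<close> is a gap, the top bead
      moves there.\<close>
    case 3
    have kpos: "0 < k" using 3 Suc.prems by linarith
    let ?b = "g + int (Suc k) * l"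
    have bl: "?b - l = g + int k * l" by (simp add: algebra_simps)
    have "\<exists>B0. P B0 \<and> g \<notin> B0 \<and> g + int k * l \<in> B0 \<and>
        (\<forall>t. \<not> l dvd t - g \<longrightarrow> (t \<in> B0 \<longleftrightarrow> t \<in> B))"
    proof (cases "g + int k * l \<in> B")
      case False
      show ?thesis
      proof (intro exI[of _ "abacus_move l B ?b"] conjI allI impI)
        show "P (abacus_move l B ?b)" using move[OF Suc.prems(1,3)] False unfolding bl by blast
      qed (use False Suc.prems l kpos in \<open>auto simp: mem_abacus_move algebra_simps\<close>)
    next
      case True
      then show ?thesis using Suc.prems by blast
    qed
    then obtain B0 where B0: "P B0" "g \<notin> B0" "g + int k * l \<in> B0"
      "\<And>t. \<not> l dvd t - g \<Longrightarrow> t \<in> B0 \<longleftrightarrow> t \<in> B" by blast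
    from Suc.IH[OF B0(1-3), of i j] 3 Suc.prems B0(4) show ?thesis by metis
  qed
qed

lemma not_dvd_window:
  assumes "g + int i * l < t" "t < g + int i * l + l"
  shows "\<not> l dvd t - g"
proof
  assume "l dvd t - g"
  then have "l dvd t - g - int i * l" by simp
  then show False using assms zdvd_not_zless[of "t - g - int i * l" l] by simp
qed

text \<open>The range is cut into windows of length \<open>l\<close>. Squeezing to one window shows
  that it is full or empty; squeezing to two consecutive ones excludes a change of type.\<close>

lemma uniform_window:
  assumes B: "P B" "g \<notin> B" "b \<in> B" "g < b" "l dvd b - g"
  shows "(\<forall>t. g < t \<longrightarrow> t < b \<longrightarrow> \<not> l dvd t - g \<longrightarrow> t \<in> B) \<or>
    (\<forall>t. g < t \<longrightarrow> t < b \<longrightarrow> \<not> l dvd t - g \<longrightarrow> t \<notin> B)"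
proof -
  have l: "0 < l" using l_ge_3 by simp
  define k where "k = nat ((b - g) div l)"
  have b: "b = g + int k * l" using B l by (simp add: k_def pos_imp_zdiv_nonneg_iff)
  have B': "P B" "g \<notin> B" "g + int k * l \<in> B" using B b by auto
  let ?full = "\<lambda>i. full_window B (g + int i * l) (g + int i * l + l)"
  let ?empty = "\<lambda>i. empty_window B (g + int i * l) (g + int i * l + l)"
  have window: "?full i \<or> ?empty i" if i: "i < k" for i
  proof -
    obtain C where C: "P C" "g + int i * l \<notin> C" "g + int (Suc i) * l \<in> C"
      "\<forall>t. \<not> l dvd t - g \<longrightarrow> (t \<in> C \<longleftrightarrow> t \<in> B)"
      using squeeze[OF B', of i "Suc i"] i by auto
    have "full_window C (g + int i * l) (g + int i * l + l) \<or>
      empty_window C (g + int i * l) (g + int i * l + l)"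
      using straight[OF C(1,3)] C(2) by (simp add: algebra_simps)
    then show ?thesis
      using C(4) not_dvd_window[of g i] unfolding full_window_def empty_window_def by blast
  qed
  have next_window: "(?full i \<longrightarrow> \<not> ?empty (Suc i)) \<and> (?empty i \<longrightarrow> \<not> ?full (Suc i))"
    if i: "Suc i < k" for i
  proof -
    obtain C where C: "P C" "g + int i * l \<notin> C" "g + int (Suc (Suc i)) * l \<in> C"
      "\<forall>t. \<not> l dvd t - g \<longrightarrow> (t \<in> C \<longleftrightarrow> t \<in> B)"
      using squeeze[OF B', of i "Suc (Suc i)"] i by auto
    have CB: "full_window C (g + int j * l) (g + int j * l + l) \<longleftrightarrow> ?full j"
      "empty_window C (g + int j * l) (g + int j * l + l) \<longleftrightarrow> ?empty j" for j
      using C(4) not_dvd_window[of g j] unfolding full_window_def empty_window_def by blast+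
    have e: "g + int (Suc (Suc i)) * l = g + int i * l + 2 * l"
      "g + int i * l + l = g + int (Suc i) * l" "g + int i * l + 2 * l = g + int (Suc i) * l + l"
      by (simp_all add: algebra_simps)
    have C3: "g + int i * l + 2 * l \<in> C" using C(3) unfolding e(1) .
    have i1: "full_window C (g + int i * l) (g + int (Suc i) * l) \<longleftrightarrow> ?full i"
      "empty_window C (g + int i * l) (g + int (Suc i) * l) \<longleftrightarrow> ?empty i"
      unfolding e(2)[symmetric] by (simp_all add: CB)
    show ?thesis using not_full_empty[OF C(1,2) C3] not_empty_full[OF C(1,2) C3]
      unfolding e(3) e(2) i1 CB by blast
  qed
  have "(\<forall>i<k. ?full i) \<or> (\<forall>i<k. ?empty i)"
  proof (cases "?full 0")
    case True
    have "i < k \<Longrightarrow> ?full i" for i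
    proof (induction i)
      case 0
      show ?case by (rule True)
    next
      case (Suc i)
      then show ?case using window[of "Suc i"] next_window[of i] by simp
    qed
    then show ?thesis by blast
  next
    case False
    have "i < k \<Longrightarrow> ?empty i" for i
    proof (induction i)
      case 0
      then show ?case using False window by blast
    next
      case (Suc i)
      then show ?case using window[of "Suc i"] next_window[of i] by simp
    qed
    then show ?thesis by blast
  qed
  moreover have "\<exists>i<k. g + int i * l < t \<and> t < g + int i * l + l"
    if t: "g < t" "t < b" "\<not> l dvd t - g" for t
  proof (intro exI conjI)
    define q where "q = (t - g) div l"
    have q: "t - g = q * l + (t - g) mod l" by (simp add: q_def)
    have m: "0 < (t - g) mod l" "(t - g) mod l < l"
      using t(3) l pos_mod_sign[of l "t - g"] by (simp_all add: dvd_eq_mod_eq_0 order_le_less)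
    have q0: "0 \<le> q" using t l by (simp add: q_def pos_imp_zdiv_nonneg_iff)
    then show "g + int (nat q) * l < t" "t < g + int (nat q) * l + l" using q m by simp_all
    have "q * l < int k * l" using q m t b by linarith
    then show "nat q < k" using l q0 by (simp add: nat_less_iff)
  qed
  ultimately show ?thesis unfolding full_window_def empty_window_def by blast
qed

text \<open>If \<open>g' < g - l\<close>, the uniform windows on the runner of \<open>g'\<close> make \<open>g - l\<close> a gap, and one descends to it.
  Otherwise they force \<open>g' = g + 1 - l\<close>, with gaps from \<open>g'\<close> to \<open>g\<close> and beads from \<open>g + 1\<close> to \<open>g + l - 1\<close>.
  Moving the bead \<open>g + 1\<close> to \<open>g'\<close> makes the window between \<open>g\<close> and \<open>g + l\<close> mixed; here \<open>l \<ge> 3\<close> is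
  needed.\<close>

lemma no_gap_below_full:
  assumes "P B" "g \<notin> B" "b \<in> B" "g < b" "l dvd b - g"
    and "\<And>t. g < t \<Longrightarrow> t < b \<Longrightarrow> \<not> l dvd t - g \<Longrightarrow> t \<in> B"
    and "g' \<notin> B" "g' < g" "\<not> l dvd g' - g"
  shows False
  using assms
proof (induction "nat (g - g')" arbitrary: g rule: less_induct)
  case less
  note B = less.prems
  have l: "3 \<le> l" by (rule l_ge_3)
  have gb: "g + l \<le> b" using B(4,5) zdvd_imp_le[of l "b - g"] by simp
  have nd: "\<not> l dvd t - g" if "g < t" "t < g + l" for t
    using that zdvd_not_zless[of "t - g" l] by simp
  have beads: "t \<in> B" if "g < t" "t < g + l" for t
    using that B(6) nd gb by simp
  \<comment> \<open>The position on the runner of \<open>g'\<close> in the window just above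
    \<open>g\<close>; it is a bead.\<close>
  define t0 where "t0 = g + (g' - g) mod l"
  have "(g' - g) mod l \<noteq> 0" using B(9) by (simp add: dvd_eq_mod_eq_0)
  moreover have "0 \<le> (g' - g) mod l" "(g' - g) mod l < l" using l by simp_all
  ultimately have t0: "g < t0" "t0 < g + l" unfolding t0_def by linarith+
  have t0d: "l dvd t0 - g'"
  proof -
    have "t0 - g' = - ((g' - g) div l * l)"
      unfolding t0_def using div_mult_mod_eq[of "g' - g" l] by linarith
    then show ?thesis by simp
  qed
  have ngg: "\<not> l dvd g - g'" using B(9) by (metis dvd_minus_iff minus_diff_eq)
  \<comment> \<open>The gap \<open>g\<close> lies between \<open>g'\<close> and \<open>t0\<close>
    and off their runner, so the uniform type there is empty.\<close>
  have gaps: "t \<notin> B" if "g' < t" "t < t0" "\<not> l dvd t - g'" for t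
    using uniform_window[OF B(1,7) beads[OF t0] _ t0d] B(2,8) t0 ngg that by auto
  show False
  proof (cases "g' < g - l")
    case True
    have d: "l dvd b - (g - l)" using dvd_add[OF B(5) dvd_refl] by (simp add: algebra_simps)
    have dd: "l dvd t - (g - l) \<longleftrightarrow> l dvd t - g" for t
      using dvd_add_left_iff[of l l "t - g"] by (simp add: algebra_simps)
    have ngl: "\<not> l dvd g - l - g'"
      using ngg dvd_diff_left_iff[of l l "g - g'"] by (simp add: algebra_simps)
    have gl: "g - l \<notin> B" using gaps[OF True _ ngl] t0 l by simp
    have one: "g + 1 \<in> B" "\<not> l dvd g + 1 - g" using beads[of "g + 1"] nd[of "g + 1"] l by auto
    \<comment> \<open>The bead \<open>g + 1\<close> is off the runner, so the range from
      \<open>g - l\<close> to \<open>b\<close> is uniformly full and the induction applies to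
      \<open>g - l\<close>.\<close>
    have "t \<in> B" if "g - l < t" "t < b" "\<not> l dvd t - (g - l)" for t
      using uniform_window[OF B(1) gl B(3) _ d] that one gb l dd[of "g + 1"] by auto
    then show False
      using less.hyps[OF _ B(1) gl B(3) _ d _ B(7) True] B(8,9) l B(4) dd
        dd[of g'] by simp
  next
    case False
    have "g' \<noteq> g - l" using B(9) by auto
    with False have g': "g - l < g'" by simp
    have "t0 - g' < 2 * l" "0 < t0 - g'" using g' t0 B(8) by linarith+
    moreover from t0d obtain k where k: "t0 - g' = l * k" by blast
    ultimately have "l * k < l * 2" "l * 0 < l * k" by linarith+
    then have "0 < k" "k < 2" using l mult_less_cancel_left_pos[of l]
      by (meson order_less_le_trans zero_less_numeral)+
    then have "k = 1" by simp
    then have t0g: "t0 = g' + l" using k by simp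
    have "\<not> g + 1 < t0"
    proof
      assume *: "g + 1 < t0"
      have "\<not> l dvd g + 1 - g'"
        using zdvd_not_zless[of "g + 1 - g'" l] * t0g B(8) by simp
      then show False using gaps[of "g + 1"] * beads[of "g + 1"] B(8) l by simp
    qed
    then have g'_eq: "g' = g + 1 - l" using t0 t0g by simp
    define k where "k = nat ((b - g) div l)"
    have b: "b = g + int k * l" using B l by (simp add: k_def pos_imp_zdiv_nonneg_iff)
    have "0 < k" using b B(4) by (cases k) auto
    then obtain C where C: "P C" "g \<notin> C" "g + l \<in> C" "\<forall>t. \<not> l dvd t - g \<longrightarrow> (t \<in> C \<longleftrightarrow> t \<in> B)"
      using squeeze[OF B(1,2), of k 0 1] B(3) b by auto
    have C1: "g + 1 \<in> C" "g + 2 \<in> C" "g + 1 - l \<notin> C"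
      using C(4) nd[of "g + 1"] nd[of "g + 2"] beads[of "g + 1"] beads[of "g + 2"] B(7,9) g'_eq l
      by auto
    let ?C = "abacus_move l C (g + 1)"
    have PC: "P ?C" using move[OF C(1) C1(1,3)] .
    have "g + l \<in> ?C" "g + l - l \<notin> ?C" using C l by (auto simp: mem_abacus_move)
    from straight[OF PC this] have "g + 1 \<in> ?C \<longleftrightarrow> g + 2 \<in> ?C"
      unfolding full_window_def empty_window_def using l by auto
    then show False using C1 l by (auto simp: mem_abacus_move)
  qed
qed

text \<open>Reflection reverses the order of two windows and complementation exchanges their types,
  so each of the two forbidden patterns is its own dual.\<close>

lemma straight_abaci_dual: "straight_abaci l (\<lambda>B. P (dual B))"
proof
  fix B b x
  assume B: "P (dual B)"
  show "P (dual (abacus_move l B b))" "full_window B (b - l) b \<or> empty_window B (b - l) b"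
    if b: "b \<in> B" "b - l \<notin> B"
  proof -
    have b': "l - b \<in> dual B" "l - b - l \<notin> dual B" using b by (simp_all add: mem_dual)
    show "P (dual (abacus_move l B b))"
      using move[OF B b'] dual_abacus_move[of l b B] b l_ge_3 by simp
    show "full_window B (b - l) b \<or> empty_window B (b - l) b"
      using straight[OF B b'] by (auto simp: window_dual)
  qed
  show "\<not> (full_window B x (x + l) \<and> empty_window B (x + l) (x + 2 * l))"
    "\<not> (empty_window B x (x + l) \<and> full_window B (x + l) (x + 2 * l))"
    if x: "x \<notin> B" "x + 2 * l \<in> B"
  proof -
    have x': "- x - 2 * l \<notin> dual B" "- x - 2 * l + 2 * l \<in> dual B"
      using x by (simp_all add: mem_dual algebra_simps)
    show "\<not> (full_window B x (x + l) \<and> empty_window B (x + l) (x + 2 * l))"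
      "\<not> (empty_window B x (x + l) \<and> full_window B (x + l) (x + 2 * l))"
      using not_full_empty[OF B x'] not_empty_full[OF B x']
      by (auto simp: window_dual algebra_simps)
  qed
qed (rule l_ge_3)

text \<open>In a violation, the uniform type of the range from \<open>g\<close> to \<open>b\<close>
  puts the off-runner gap \<open>g'\<close> below \<open>g\<close> or the off-runner bead
  \<open>b'\<close> above \<open>b\<close>. Both are excluded by \<open>no_gap_below_full\<close>,
  the latter in the dual.\<close>

theorem JM_abacus_if_straight:
  assumes B: "P B"
  shows "JM_abacus l B"
proof (rule ccontr)
  assume "\<not> JM_abacus l B"
  then obtain b g g' b' where b: "b \<in> B" and g: "g \<notin> B" and gb: "g < b" "l dvd b - g"
    and g': "g' \<notin> B" "g' < b" "\<not> l dvd b - g'" and b': "b' \<in> B" "g < b'" "\<not> l dvd b' - g"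
    unfolding JM_abacus_def by blast
  have g'g: "\<not> l dvd g' - g"
    using g'(3) dvd_diff[OF gb(2), of "g' - g"] by auto
  have b'b: "\<not> l dvd b' - b"
    using b'(3) dvd_add[OF gb(2), of "b' - b"] by auto
  from uniform_window[OF B g b gb] show False
  proof
    assume *: "\<forall>t. g < t \<longrightarrow> t < b \<longrightarrow> \<not> l dvd t - g \<longrightarrow> t \<in> B"
    then have "g' < g" using g' g'g by (cases g g' rule: linorder_cases) auto
    then show False using no_gap_below_full[OF B g b gb] * g' g'g by blast
  next
    assume *: "\<forall>t. g < t \<longrightarrow> t < b \<longrightarrow> \<not> l dvd t - g \<longrightarrow> t \<notin> B"
    then have bb': "b < b'" using b' b'b by (cases b b' rule: linorder_cases) auto
    interpret D: straight_abaci l "\<lambda>B. P (dual B)" by (rule straight_abaci_dual)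
    have t: "t \<in> dual B" if "- b < t" "t < - g" "\<not> l dvd t - - b" for t
    proof -
      have "\<not> l dvd - t - g"
        using that(3) dvd_diff[OF gb(2), of "- t - g"] by (auto simp: algebra_simps)
      then show ?thesis using * that by (simp add: mem_dual)
    qed
    show False
    proof (rule D.no_gap_below_full[of "dual B" "- b" "- g" "- b'"])
      show "l dvd - g - - b" using gb by simp
      have "l dvd b' - b \<longleftrightarrow> l dvd - b' - - b"
        using dvd_minus_iff[of l "b' - b"] by simp
      then show "\<not> l dvd - b' - - b" using b'b by simp
    qed (use B b g gb b' bb' t in \<open>auto simp: dual_dual mem_dual\<close>)
  qed
qed

end

section \<open>Beads of a partition\<close>

text \<open>Rows are continued by zeros, so that every sufficiently small integer is a bead.\<close>

definition row_length :: "nat list \<Rightarrow> nat \<Rightarrow> nat" where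
  "row_length lam i = (if i < length lam then lam ! i else 0)"

definition bead :: "nat list \<Rightarrow> nat \<Rightarrow> int" where
  "bead lam i = int (row_length lam i) - int i - 1"

definition beads :: "nat list \<Rightarrow> int set" where
  "beads lam = range (bead lam)"

definition bead_rank :: "nat list \<Rightarrow> int \<Rightarrow> nat" where
  "bead_rank lam t = card {i. t \<le> bead lam i}"

text \<open>Among the boxes \<open>(x, y)\<close> of content \<open>y - x = t\<close> those in the diagram are the ones with
  \<open>x < bead_rank lam t\<close>; \<open>rim_box lam t\<close> is the last of them. If there is none, truncated
  subtraction makes its value meaningless.\<close>

definition rim_box :: "nat list \<Rightarrow> int \<Rightarrow> nat \<times> nat" where
  "rim_box lam t = (bead_rank lam t - 1, nat (int (bead_rank lam t) - 1 + t))"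

definition content :: "nat \<times> nat \<Rightarrow> int" where
  "content u = int (snd u) - int (fst u)"

lemma mem_young_diagram: "(x, y) \<in> young_diagram lam \<longleftrightarrow> y < row_length lam x"
  by (auto simp: young_diagram_def row_length_def)

lemma finite_young_diagram: "finite (young_diagram lam)"
proof (rule finite_subset)
  show "young_diagram lam \<subseteq> Sigma {..<length lam} (\<lambda>x. {..<lam ! x})"
    by (auto simp: young_diagram_def)
qed simp

lemma row_length_antimono:
  assumes "is_partition lam" "i \<le> j"
  shows "row_length lam j \<le> row_length lam i"
proof (cases "i = j \<or> \<not> j < length lam")
  case False
  then show ?thesis
    using assms sorted_wrt_nth_less[of "(\<ge>)" lam i j] by (simp add: is_partition_def row_length_def)
qed (auto simp: row_length_def)

lemma young_diagram_down:
  assumes "is_partition lam" "(x, y) \<in> young_diagram lam" "x' \<le> x" "y' \<le> y"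
  shows "(x', y') \<in> young_diagram lam"
  using assms row_length_antimono[OF assms(1,3)] by (simp add: mem_young_diagram)

lemma bead_strict_antimono:
  assumes "is_partition lam" "i < j"
  shows "bead lam j < bead lam i"
  using row_length_antimono[OF assms(1), of i j] assms(2) by (simp add: bead_def)

lemma bead_antimono:
  assumes "is_partition lam" "i \<le> j"
  shows "bead lam j \<le> bead lam i"
  using bead_strict_antimono[OF assms(1), of i j] assms(2) by (cases "i = j") auto

lemma finite_beads_above:
  assumes "is_partition lam"
  shows "finite {i. t \<le> bead lam i}"
proof (rule finite_subset)
  show "{i. t \<le> bead lam i} \<subseteq> {..nat (int (row_length lam 0) - t)}"
  proof safe
    fix i assume "t \<le> bead lam i"
    then show "i \<le> nat (int (row_length lam 0) - t)"
      using row_length_antimono[OF assms, of 0 i] by (simp add: bead_def)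
  qed
qed simp

lemma finite_down_closed_nat:
  fixes A :: "nat set"
  assumes "finite A" "\<And>i j. j \<in> A \<Longrightarrow> i \<le> j \<Longrightarrow> i \<in> A"
  shows "A = {..<card A}"
proof (cases "A = {}")
  case False
  have "A = {..Max A}"
    using assms(2)[OF Max_in[OF assms(1) False]] Max_ge[OF assms(1)] by blast
  then have "card A = Suc (Max A)" by (metis card_atMost)
  then show ?thesis using \<open>A = {..Max A}\<close> lessThan_Suc_atMost by metis
qed simp

lemma le_bead_iff:
  assumes "is_partition lam"
  shows "t \<le> bead lam i \<longleftrightarrow> i < bead_rank lam t"
proof -
  have "{i. t \<le> bead lam i} = {..<card {i. t \<le> bead lam i}}"
  proof (rule finite_down_closed_nat[OF finite_beads_above[OF assms]])
    fix i j assume "j \<in> {i. t \<le> bead lam i}" "i \<le> j"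
    then show "i \<in> {i. t \<le> bead lam i}" using bead_antimono[OF assms, of i j] by simp
  qed
  then show ?thesis unfolding bead_rank_def by blast
qed

lemma bead_rank_step:
  assumes "is_partition lam"
  shows "bead_rank lam t = bead_rank lam (t + 1) + of_bool (t \<in> beads lam)"
proof (cases "t \<in> beads lam")
  case True
  then obtain i where i: "t = bead lam i" by (auto simp: beads_def)
  have "t \<le> bead lam j \<longleftrightarrow> j \<le> i" for j
    using i bead_antimono[OF assms, of j i] bead_strict_antimono[OF assms, of i j] by linarith
  then have a: "bead_rank lam t = Suc i"
    by (simp add: bead_rank_def flip: atMost_def)
  have "t + 1 \<le> bead lam j \<longleftrightarrow> j < i" for j
    using i bead_antimono[OF assms, of i j] bead_strict_antimono[OF assms, of j i] by linarith
  then have "bead_rank lam (t + 1) = i"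
    by (simp add: bead_rank_def flip: lessThan_def)
  with a True show ?thesis by simp
next
  case False
  then have "t \<noteq> bead lam i" for i by (auto simp: beads_def)
  then have "{i. t \<le> bead lam i} = {i. t + 1 \<le> bead lam i}"
    by (metis add1_zle_eq order_le_less)
  with False show ?thesis by (simp add: bead_rank_def)
qed

lemma mem_beads_iff:
  assumes "is_partition lam"
  shows "t \<in> beads lam \<longleftrightarrow> bead_rank lam t = Suc (bead_rank lam (t + 1))"
    "t \<notin> beads lam \<longleftrightarrow> bead_rank lam t = bead_rank lam (t + 1)"
  using bead_rank_step[OF assms, of t] by (auto simp: of_bool_def split: if_splits)

text \<open>The \<open>- 1\<close> in \<open>bead\<close> turns \<open>y < row_length lam x\<close>
  into the weak inequality between the content and bead \<open>x\<close>.\<close>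

lemma mem_young_diagram_rank:
  assumes "is_partition lam"
  shows "(x, y) \<in> young_diagram lam \<longleftrightarrow> x < bead_rank lam (int y - int x)"
  unfolding le_bead_iff[OF assms, symmetric] mem_young_diagram by (auto simp: bead_def)

text \<open>For negative \<open>t\<close> the first \<open>- t\<close> rows have beads at least
  \<open>t\<close>, even if they are empty.\<close>

lemma bead_rank_ge:
  assumes "is_partition lam"
  shows "0 \<le> int (bead_rank lam t) + t"
proof (cases "t < 0")
  case True
  then have "t \<le> bead lam (nat (- t) - 1)" by (simp add: bead_def)
  then show ?thesis using True unfolding le_bead_iff[OF assms] by linarith
qed simp

text \<open>The sum of rank and position stays the same across a bead and grows by one across a gap.
  Being positive, it keeps the column in \<open>rim_box\<close> from truncation.\<close>

lemma bead_rank_pos_above_gap: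
  assumes "is_partition lam" "g \<notin> beads lam" "g < t"
  shows "0 < int (bead_rank lam t) + t"
  using assms(3)
proof (induction t rule: int_gr_induct)
  case base
  then show ?case using bead_rank_ge[OF assms(1), of g] mem_beads_iff(2)[OF assms(1), of g] assms(2)
    by simp
next
  case (step t)
  then show ?case using bead_rank_step[OF assms(1), of t] by (simp add: of_bool_def split: if_splits)
qed

lemma bead_rank_pos_below_bead:
  assumes "is_partition lam" "b \<in> beads lam" "t \<le> b"
  shows "0 < bead_rank lam t"
proof -
  obtain i where "b = bead lam i" using assms(2) unfolding beads_def by blast
  then have "i < bead_rank lam t" using assms(3) le_bead_iff[OF assms(1)] by blast
  then show ?thesis by simp
qed

lemma rim_box_coords:
  assumes "is_partition lam" "b \<in> beads lam" "g \<notin> beads lam" "g < t" "t \<le> b"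
  shows "int (fst (rim_box lam t)) = int (bead_rank lam t) - 1"
    "int (snd (rim_box lam t)) = int (bead_rank lam t) - 1 + t"
    "content (rim_box lam t) = t"
proof -
  have r: "0 < bead_rank lam t" "0 < int (bead_rank lam t) + t"
    using bead_rank_pos_below_bead[OF assms(1,2,5)] bead_rank_pos_above_gap[OF assms(1,3,4)] .
  from r(1) show 1: "int (fst (rim_box lam t)) = int (bead_rank lam t) - 1"
    by (simp add: rim_box_def of_nat_diff)
  from r(2) show 2: "int (snd (rim_box lam t)) = int (bead_rank lam t) - 1 + t"
    by (simp add: rim_box_def)
  show "content (rim_box lam t) = t"
    unfolding content_def 1 2 by simp
qed

section \<open>Contents, connectedness and removal of rim hooks\<close>

lemma share_edge_content: "share_edge u v \<Longrightarrow> \<bar>content u - content v\<bar> = 1"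
  by (cases u, cases v, simp add: share_edge_def content_def, elim disjE conjE, simp_all)

lemma share_edge_sym: "share_edge u v \<longleftrightarrow> share_edge v u"
  by (cases u, cases v, simp add: share_edge_def, metis)

text \<open>A discrete intermediate value argument: the content changes by exactly one along each
  edge.\<close>

lemma path_content:
  assumes "(\<lambda>u v. u \<in> R \<and> v \<in> R \<and> share_edge u v)\<^sup>*\<^sup>* p q" "p \<in> R"
    "content p \<le> t" "t \<le> content q"
  shows "\<exists>u\<in>R. content u = t"
  using assms
proof (induction rule: rtranclp_induct)
  case base
  then show ?case by force
next
  case (step y z)
  show ?case
  proof (cases "t \<le> content y")
    case False
    then have "t = content z" using step.prems step.hyps share_edge_content[of y z] by auto
    then show ?thesis using step.hyps by blast
  qed (use step in blast)
qed

lemma convex_int_interval: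
  fixes C :: "int set"
  assumes "finite C" "C \<noteq> {}" "\<And>a b t. a \<in> C \<Longrightarrow> b \<in> C \<Longrightarrow> a \<le> t \<Longrightarrow> t \<le> b \<Longrightarrow> t \<in> C"
  shows "C = {Max C - int (card C)<..Max C}"
proof -
  have C: "C = {Min C..Max C}"
  proof
    show "C \<subseteq> {Min C..Max C}" using assms(1) by auto
    show "{Min C..Max C} \<subseteq> C"
      using assms(3)[OF Min_in[OF assms(1,2)] Max_in[OF assms(1,2)]]
      by (meson atLeastAtMost_iff subsetI)
  qed
  have "Min C \<le> Max C" using assms(1,2) by simp
  moreover have "card C = card {Min C..Max C}" using C by (rule arg_cong)
  ultimately have "Min C = Max C - int (card C) + 1" by simp
  moreover have "{Max C - int (card C) + 1..Max C} = {Max C - int (card C)<..Max C}" by auto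
  ultimately show ?thesis using C by metis
qed

text \<open>A rim hook has exactly one box of each content in an interval of length \<open>l\<close>: connectedness gives
  the interval, the absence of squares gives uniqueness. Since \<open>t\<close> is a bead iff the rank drops by
  one from \<open>t\<close> to \<open>t + 1\<close>, removing it changes beads only at the two ends of the interval.\<close>

lemma removes_rim_hook_beads:
  assumes lam: "is_partition lam" and l: "0 < l" and rem: "removes_rim_hook l lam R mu"
  obtains b where "b \<in> beads lam" "b - int l \<notin> beads lam"
    "beads mu = abacus_move (int l) (beads lam) b" "R = rim_box lam ` {b - int l<..b}"
    "\<And>t. int (bead_rank mu t) = int (bead_rank lam t) - of_bool (b - int l < t \<and> t \<le> b)"
proof -
  have sub: "R \<subseteq> young_diagram lam" and cardR: "card R = l" and conn: "connected_boxes R"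
    and nsq: "\<not> contains_square R" and mu: "is_partition mu"
    and diag: "young_diagram mu = young_diagram lam - R"
    using rem by (auto simp: removes_rim_hook_def)
  have down: "(x', y') \<in> young_diagram mu"
    if "(x, y) \<in> young_diagram mu" "x' \<le> x" "y' \<le> y" for x y x' y'
    using young_diagram_down[OF mu] that by blast
  \<comment> \<open>Otherwise all four boxes of the square starting at \<open>(x, y)\<close> lie in
    \<open>lam\<close> and, by downward closure, outside \<open>mu\<close>, hence in
    \<open>R\<close>.\<close>
  have rim: "(Suc x, Suc y) \<notin> young_diagram lam" if xy: "(x, y) \<in> R" for x y
  proof
    assume *: "(Suc x, Suc y) \<in> young_diagram lam"
    have "(x', y') \<in> R" if "(x', y') \<in> {(x, y), (Suc x, y), (x, Suc y), (Suc x, Suc y)}" for x' y'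
    proof -
      have le: "x \<le> x'" "y \<le> y'" "x' \<le> Suc x" "y' \<le> Suc y" using that by auto
      have "(x, y) \<notin> young_diagram mu" using xy diag by blast
      then have "(x', y') \<notin> young_diagram mu" using down le by blast
      moreover have "(x', y') \<in> young_diagram lam" using young_diagram_down[OF lam *] le by blast
      ultimately show ?thesis using diag by blast
    qed
    then have "contains_square R" unfolding contains_square_def by blast
    then show False using nsq by blast
  qed
  \<comment> \<open>On its diagonal the box is the last one of \<open>lam\<close>, and its
    predecessor, if any, survives in \<open>mu\<close>.\<close>
  have R_rank: "bead_rank lam (content u) = Suc (fst u) \<and> bead_rank mu (content u) = fst u"
    if u: "u \<in> R" for u
  proof -
    obtain x y where xy: "u = (x, y)" by fastforce
    have "(x, y) \<in> young_diagram lam" using u xy sub by blast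
    then have a: "x < bead_rank lam (int y - int x)" by (simp add: mem_young_diagram_rank[OF lam])
    have "\<not> Suc x < bead_rank lam (int (Suc y) - int (Suc x))"
      using rim u unfolding xy mem_young_diagram_rank[OF lam, symmetric] by blast
    then have lamr: "bead_rank lam (int y - int x) = Suc x" using a by simp
    have "(x, y) \<notin> young_diagram mu" using u xy diag by blast
    then have b: "bead_rank mu (int y - int x) \<le> x" by (simp add: mem_young_diagram_rank[OF mu])
    have "bead_rank mu (int y - int x) = x"
    proof (cases "x = 0 \<or> y = 0")
      case True
      then show ?thesis using b bead_rank_ge[OF mu, of "int y - int x"] by auto
    next
      case False
      then obtain x' y' where s: "x = Suc x'" "y = Suc y'" by (metis not0_implies_Suc)
      have "(x', y') \<notin> R" using rim[of x' y'] u sub xy s by blast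
      moreover have "(x', y') \<in> young_diagram lam"
        using young_diagram_down[OF lam, of x y] u sub xy s by auto
      ultimately have "(x', y') \<in> young_diagram mu" using diag by blast
      then show ?thesis using b by (simp add: mem_young_diagram_rank[OF mu] s)
    qed
    with lamr show ?thesis by (simp add: xy content_def)
  qed
  have R_box: "u = rim_box lam (content u)" if "u \<in> R" for u
    using R_rank[OF that] by (cases u) (simp add: rim_box_def content_def)
  define C where "C = content ` R"
  have R_C: "R = rim_box lam ` C" using R_box by (force simp: C_def)
  have finR: "finite R" using finite_subset[OF sub finite_young_diagram] .
  have "inj_on content R" by (metis R_box inj_onI)
  then have cardC: "card C = l" using cardR by (simp add: C_def card_image)
  then have ne: "C \<noteq> {}" "finite C" using l card_gt_0_iff by force+
  have convex: "t \<in> C" if ab: "a \<in> C" "b \<in> C" "a \<le> t" "t \<le> b" for a b t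
  proof -
    obtain p q where pq: "p \<in> R" "q \<in> R" "a = content p" "b = content q"
      using ab by (auto simp: C_def)
    then have "\<exists>u\<in>R. content u = t"
      using path_content[of R p q t] conn ab unfolding connected_boxes_def by blast
    then show ?thesis by (auto simp: C_def)
  qed
  have "C = {Max C - int l<..Max C}"
    using convex_int_interval[OF ne(2,1)] convex cardC by blast
  then obtain b where C: "C = {b - int l<..b}" ..
  have rank: "int (bead_rank mu t) = int (bead_rank lam t) - of_bool (b - int l < t \<and> t \<le> b)" for t
  proof (cases "t \<in> C")
    case True
    then obtain u where "u \<in> R" "t = content u" by (auto simp: C_def)
    then show ?thesis using R_rank[of u] True C by simp
  next
    case False
    have box: "(x, nat (t + int x)) \<in> R \<longleftrightarrow> bead_rank mu t \<le> x \<and> x < bead_rank lam t"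
      if "0 \<le> t + int x" for x
    proof -
      have e: "int (nat (t + int x)) - int x = t" using that by simp
      show ?thesis
        using diag sub mem_young_diagram_rank[OF lam, of x "nat (t + int x)"]
          mem_young_diagram_rank[OF mu, of x "nat (t + int x)"] unfolding e by auto
    qed
    have cont: "content (x, nat (t + int x)) = t" if "0 \<le> t + int x" for x
      using that by (simp add: content_def)
    have sub': "x < bead_rank mu t \<Longrightarrow> x < bead_rank lam t" for x
    proof -
      assume "x < bead_rank mu t"
      then have "t \<le> bead mu x" by (simp add: le_bead_iff[OF mu])
      moreover have "row_length mu x \<le> row_length lam x"
        using diag mem_young_diagram[of x _ mu] mem_young_diagram[of x _ lam]
        by (metis DiffD1 linorder_not_le order_less_irrefl)
      ultimately show ?thesis unfolding le_bead_iff[OF lam, symmetric] by (simp add: bead_def)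
    qed
    have "bead_rank mu t = bead_rank lam t"
    proof (rule ccontr)
      assume ne: "bead_rank mu t \<noteq> bead_rank lam t"
      have "\<not> bead_rank lam t < bead_rank mu t" using sub'[of "bead_rank lam t"] by blast
      with ne have lt: "bead_rank mu t < bead_rank lam t" by simp
      \<comment> \<open>The box in row \<open>bead_rank mu t\<close> of this diagonal would have
        been removed although \<open>t\<close> is not in \<open>C\<close>. The bound makes its
        column nonnegative.\<close>
      have ge: "0 \<le> t + int (bead_rank mu t)" using bead_rank_ge[OF mu, of t] by simp
      have "t \<in> content ` R" using box[OF ge] lt cont[OF ge] by (metis image_eqI order_refl)
      then show False using False by (simp add: C_def)
    qed
    then show ?thesis using False C by auto
  qed
  \<comment> \<open>The drop of rank from \<open>t\<close> to \<open>t + 1\<close> grows by one at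
    \<open>b - int l\<close> and shrinks by one at \<open>b\<close>, and nowhere else changes. As
    every drop is 0 or 1, \<open>b\<close> was a bead and \<open>b - int l\<close> a gap.\<close>
  have key: "t \<in> beads mu \<longleftrightarrow> t = b - int l \<or> t \<in> beads lam \<and> t \<noteq> b"
    "t = b \<Longrightarrow> t \<in> beads lam" "t = b - int l \<Longrightarrow> t \<notin> beads lam" for t
    using rank[of t] rank[of "t + 1"] bead_rank_step[OF lam, of t] bead_rank_step[OF mu, of t] l
    by (auto simp: of_bool_def split: if_splits)
  show thesis
  proof (rule that)
    show "beads mu = abacus_move (int l) (beads lam) b" using key(1) mem_abacus_move by blast
    show "b \<in> beads lam" "b - int l \<notin> beads lam" using key(2,3) by blast+
    show "R = rim_box lam ` {b - int l<..b}" using R_C C by simp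
  qed (rule rank)
qed

lemma young_diagram_exists:
  assumes "finite E" and down: "\<And>x y x' y'. (x, y) \<in> E \<Longrightarrow> x' \<le> x \<Longrightarrow> y' \<le> y \<Longrightarrow> (x', y') \<in> E"
  shows "\<exists>mu. is_partition mu \<and> young_diagram mu = E"
proof -
  define r where "r x = card {y. (x, y) \<in> E}" for x
  define n where "n = card {x. (x, 0) \<in> E}"
  have fin: "finite {y. (x, y) \<in> E}" "finite {x. (x, y) \<in> E}" for x y
    using finite_vimageI[OF assms(1), of "Pair x"] finite_vimageI[OF assms(1), of "\<lambda>x. (x, y)"]
    by (auto simp: vimage_def inj_on_def)
  have r: "(x, y) \<in> E \<longleftrightarrow> y < r x" for x y
    using finite_down_closed_nat[OF fin(1)[of x]] down unfolding r_def by blast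
  have n: "(x, 0) \<in> E \<longleftrightarrow> x < n" for x
    using finite_down_closed_nat[OF fin(2)[of 0]] down unfolding n_def by blast
  have mono: "r j \<le> r i" if "i \<le> j" for i j
  proof (rule ccontr)
    assume "\<not> r j \<le> r i"
    then have "(j, r i) \<in> E" using r by simp
    then have "(i, r i) \<in> E" using down that by blast
    then show False using r by simp
  qed
  have pos: "0 < r i \<longleftrightarrow> i < n" for i using n[of i] r[of i 0] by simp
  have "0 \<notin> set (map r [0..<n])"
  proof
    assume "0 \<in> set (map r [0..<n])"
    then obtain i where "i < n" "r i = 0" by auto
    then show False using pos[of i] by simp
  qed
  then have "is_partition (map r [0..<n])"
    unfolding is_partition_def sorted_wrt_iff_nth_less using mono by simp
  moreover have "(x, y) \<in> young_diagram (map r [0..<n]) \<longleftrightarrow> (x, y) \<in> E" for x y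
    using pos[of x] unfolding young_diagram_def r by auto
  then have "young_diagram (map r [0..<n]) = E" by auto
  ultimately show ?thesis by blast
qed

lemma connected_boxes_rim:
  assumes "\<And>t. a < t \<Longrightarrow> t < b \<Longrightarrow> share_edge (f t) (f (t + 1))"
  shows "connected_boxes (f ` {a<..b :: int})"
proof -
  define E where "E = (\<lambda>u v. u \<in> f ` {a<..b} \<and> v \<in> f ` {a<..b} \<and> share_edge u v)"
  have up: "E\<^sup>*\<^sup>* (f s) (f t) \<and> E\<^sup>*\<^sup>* (f t) (f s)" if "a < s" "s \<le> t" "t \<le> b" for s t
    using that(2,3)
  proof (induction t rule: int_ge_induct)
    case (step t)
    then have "f t \<in> f ` {a<..b}" "f (t + 1) \<in> f ` {a<..b}" "share_edge (f t) (f (t + 1))"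
      using assms[of t] that(1) by auto
    then have "E (f t) (f (t + 1))" "E (f (t + 1)) (f t)"
      using share_edge_sym by (auto simp: E_def)
    moreover have "E\<^sup>*\<^sup>* (f s) (f t) \<and> E\<^sup>*\<^sup>* (f t) (f s)" using step by simp
    ultimately show ?case
      by (meson converse_rtranclp_into_rtranclp rtranclp.rtrancl_into_rtrancl)
  qed simp
  show ?thesis unfolding connected_boxes_def E_def[symmetric]
  proof (intro ballI)
    fix p q assume "p \<in> f ` {a<..b}" "q \<in> f ` {a<..b}"
    then obtain s t where "p = f s" "q = f t" "a < s" "s \<le> b" "a < t" "t \<le> b" by auto
    then show "E\<^sup>*\<^sup>* p q" using up[of s t] up[of t s] by (cases "s \<le> t") auto
  qed
qed

text \<open>The hook consists of the last boxes on the diagonals with content in the interval. The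
  gap \<open>b - int l\<close> and the bead \<open>b\<close> at its ends ensure that the remaining
  boxes are closed downwards.\<close>

lemma removes_rim_hook_exists:
  assumes lam: "is_partition lam" and l: "0 < l"
    and b: "b \<in> beads lam" "b - int l \<notin> beads lam"
  obtains mu where "removes_rim_hook l lam (rim_box lam ` {b - int l<..b}) mu"
    "beads mu = abacus_move (int l) (beads lam) b"
    "\<And>t. int (bead_rank mu t) = int (bead_rank lam t) - of_bool (b - int l < t \<and> t \<le> b)"
proof -
  define R where "R = rim_box lam ` {b - int l<..b}"
  have coords: "int (fst (rim_box lam t)) = int (bead_rank lam t) - 1"
    "int (snd (rim_box lam t)) = int (bead_rank lam t) - 1 + t" "content (rim_box lam t) = t"
    if "t \<in> {b - int l<..b}" for t
    using rim_box_coords[OF lam b] that by auto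
  have R_iff: "(x, y) \<in> R \<longleftrightarrow>
    b - int l < int y - int x \<and> int y - int x \<le> b \<and> bead_rank lam (int y - int x) = Suc x" for x y
  proof
    assume "(x, y) \<in> R"
    then obtain t where t: "t \<in> {b - int l<..b}" "(x, y) = rim_box lam t" by (auto simp: R_def)
    from coords[OF t(1)] t show "b - int l < int y - int x \<and> int y - int x \<le> b \<and>
      bead_rank lam (int y - int x) = Suc x"
      unfolding t(2)[symmetric] by (auto simp: content_def)
  next
    assume *: "b - int l < int y - int x \<and> int y - int x \<le> b \<and> bead_rank lam (int y - int x) = Suc x"
    then have "rim_box lam (int y - int x) = (x, y)" by (simp add: rim_box_def)
    then show "(x, y) \<in> R" using * unfolding R_def by (metis greaterThanAtMost_iff image_eqI)
  qed
  have sub: "R \<subseteq> young_diagram lam" using R_iff mem_young_diagram_rank[OF lam] by auto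
  have inj: "inj_on (rim_box lam) {b - int l<..b}" by (metis coords(3) inj_onI)
  have card: "card R = l" unfolding R_def by (simp add: card_image[OF inj])
  have conn: "connected_boxes R" unfolding R_def
  proof (rule connected_boxes_rim)
    fix t assume t: "b - int l < t" "t < b"
    \<comment> \<open>From \<open>t\<close> to \<open>t + 1\<close> the rim steps up if
      \<open>t\<close> is a bead and right if it is a gap.\<close>
    show "share_edge (rim_box lam t) (rim_box lam (t + 1))"
      using coords(1,2)[of t] coords(1,2)[of "t + 1"] t bead_rank_step[OF lam, of t]
      by (auto simp: share_edge_def of_bool_def split: prod.splits if_splits)
  qed
  have nsq: "\<not> contains_square R"
  proof
    assume "contains_square R"
    then obtain x y where "(x, y) \<in> R" "(Suc x, Suc y) \<in> R" by (auto simp: contains_square_def)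
    then show False unfolding R_iff by simp
  qed
  \<comment> \<open>A step down lowers the content by one and arrives at a bead; as
    \<open>b - int l\<close> is a gap, it stays in the interval.\<close>
  have below: "(Suc x, y) \<in> R" if "(x, y) \<in> R" "(Suc x, y) \<in> young_diagram lam" for x y
  proof -
    let ?t = "int y - int (Suc x)"
    have r: "bead_rank lam (?t + 1) = Suc x" "b - int l < ?t + 1" "?t + 1 \<le> b"
      using that(1) unfolding R_iff by auto
    have "Suc x < bead_rank lam ?t" using that(2) mem_young_diagram_rank[OF lam] by blast
    then have "?t \<in> beads lam \<and> bead_rank lam ?t = Suc (Suc x)"
      using bead_rank_step[OF lam, of ?t] r by (auto simp: of_bool_def split: if_splits)
    moreover then have "?t \<noteq> b - int l" using b by metis
    ultimately show ?thesis using r unfolding R_iff by linarith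
  qed
  \<comment> \<open>A step right is possible only from a gap; as \<open>b\<close> is a bead, the
    content does not pass \<open>b\<close>.\<close>
  have right: "(x, Suc y) \<in> R" if "(x, y) \<in> R" "(x, Suc y) \<in> young_diagram lam" for x y
  proof -
    let ?t = "int y - int x"
    have r: "bead_rank lam ?t = Suc x" "b - int l < ?t" "?t \<le> b"
      using that(1) unfolding R_iff by auto
    have e: "int (Suc y) - int x = ?t + 1" by simp
    have "x < bead_rank lam (?t + 1)" using that(2) mem_young_diagram_rank[OF lam] e by metis
    then have "?t \<notin> beads lam \<and> bead_rank lam (?t + 1) = Suc x"
      using bead_rank_step[OF lam, of ?t] r by (auto simp: of_bool_def split: if_splits)
    moreover then have "?t \<noteq> b" using b by metis
    ultimately show ?thesis using r unfolding R_iff e by linarith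
  qed
  have up: "(x + i, y + j) \<in> R" if xy: "(x, y) \<in> R" "(x + i, y + j) \<in> young_diagram lam" for x y i j
  proof -
    have "(x + i, y) \<in> R" if "(x + i, y) \<in> young_diagram lam" using that
    proof (induction i)
      case (Suc i)
      then show ?case using below[of "x + i" y] young_diagram_down[OF lam Suc.prems] by simp
    qed (use xy in simp)
    then have "(x + i, y) \<in> R" using young_diagram_down[OF lam xy(2)] by simp
    then show ?thesis using xy(2)
    proof (induction j)
      case (Suc j)
      then show ?case using right[of "x + i" "y + j"] young_diagram_down[OF lam Suc.prems(2)] by simp
    qed simp
  qed
  have "\<exists>mu. is_partition mu \<and> young_diagram mu = young_diagram lam - R"
  proof (rule young_diagram_exists)
    fix x y x' y' assume *: "(x, y) \<in> young_diagram lam - R" "x' \<le> x" "y' \<le> y"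
    then have "(x', y') \<in> young_diagram lam" using young_diagram_down[OF lam] by blast
    moreover have "(x', y') \<notin> R" using up[of x' y' "x - x'" "y - y'"] * by auto
    ultimately show "(x', y') \<in> young_diagram lam - R" by blast
  qed (simp add: finite_young_diagram)
  then obtain mu where mu: "removes_rim_hook l lam R mu"
    using sub card conn nsq by (auto simp: removes_rim_hook_def)
  obtain c where c: "c \<in> beads lam" "c - int l \<notin> beads lam"
    "beads mu = abacus_move (int l) (beads lam) c" "R = rim_box lam ` {c - int l<..c}"
    "\<And>t. int (bead_rank mu t) = int (bead_rank lam t) - of_bool (c - int l < t \<and> t \<le> c)"
    using removes_rim_hook_beads[OF lam l mu] by metis
  have "content ` R = {b - int l<..b}" using coords(3) by (force simp: R_def image_iff)
  moreover have "content ` R = {c - int l<..c}"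
    using rim_box_coords(3)[OF lam c(1,2)] unfolding c(4) by (force simp: image_iff)
  ultimately have "{b - int l<..b} = {c - int l<..c}" by simp
  then have "b \<in> {c - int l<..c}" "c \<in> {b - int l<..b}" using l by auto
  then have "b = c" by simp
  then show thesis using that[of mu] mu c unfolding R_def by blast
qed

section \<open>Straight and adjacent rim hooks\<close>

lemma constant_on_int_interval:
  fixes f :: "int \<Rightarrow> 'a"
  assumes "\<And>t. a < t \<Longrightarrow> t < b \<Longrightarrow> f t = f (t + 1)" "a < t" "t \<le> b"
  shows "f t = f b"
  using assms(3,2)
proof (induction t rule: int_le_induct)
  case (step t)
  then show ?case using assms(1)[of "t - 1"] by simp
qed simp

lemma horizontal_iff_fst: "horizontal R \<longleftrightarrow> (\<exists>i. \<forall>u\<in>R. fst u = i)"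
  by (simp add: horizontal_def case_prod_beta)

lemma vertical_iff_snd: "vertical R \<longleftrightarrow> (\<exists>j. \<forall>u\<in>R. snd u = j)"
  by (simp add: vertical_def case_prod_beta)

text \<open>The row of the rim box of content \<open>t\<close> is the rank minus one, which changes
  from \<open>t\<close> to \<open>t + 1\<close> exactly when \<open>t\<close> is a bead. Both boxes
  belong to the hook iff \<open>t\<close> is strictly inside the window.\<close>

lemma horizontal_rim_iff:
  assumes lam: "is_partition lam" and b: "b \<in> beads lam" "b - int l \<notin> beads lam"
  shows "horizontal (rim_box lam ` {b - int l<..b}) \<longleftrightarrow> empty_window (beads lam) (b - int l) b"
proof
  note row = rim_box_coords(1)[OF lam b]
  assume "horizontal (rim_box lam ` {b - int l<..b})"
  then obtain i where i: "\<And>u. u \<in> rim_box lam ` {b - int l<..b} \<Longrightarrow> fst u = i"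
    unfolding horizontal_iff_fst by blast
  have "t \<notin> beads lam" if t: "b - int l < t" "t < b" for t
  proof -
    have "fst (rim_box lam t) = i" "fst (rim_box lam (t + 1)) = i"
      using t by (auto intro!: i)
    then have "int (bead_rank lam t) = int (bead_rank lam (t + 1))"
      using row[of t] row[of "t + 1"] t by linarith
    then show ?thesis using mem_beads_iff(2)[OF lam, of t] by linarith
  qed
  then show "empty_window (beads lam) (b - int l) b" by (simp add: empty_window_def)
next
  assume e: "empty_window (beads lam) (b - int l) b"
  have rank: "bead_rank lam t = bead_rank lam b" if "b - int l < t" "t \<le> b" for t
  proof (rule constant_on_int_interval[OF _ that])
    fix s assume "b - int l < s" "s < b"
    then show "bead_rank lam s = bead_rank lam (s + 1)"
      using e mem_beads_iff(2)[OF lam, of s] by (simp add: empty_window_def)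
  qed
  have "fst u = fst (rim_box lam b)" if u: "u \<in> rim_box lam ` {b - int l<..b}" for u
  proof -
    obtain t where t: "u = rim_box lam t" "b - int l < t" "t \<le> b" using u by auto
    show ?thesis unfolding t(1) rim_box_def fst_conv rank[OF t(2,3)] ..
  qed
  then show "horizontal (rim_box lam ` {b - int l<..b})"
    unfolding horizontal_iff_fst by blast
qed

text \<open>The column is the rank minus one plus the content, which changes exactly across
  gaps.\<close>

lemma vertical_rim_iff:
  assumes lam: "is_partition lam" and b: "b \<in> beads lam" "b - int l \<notin> beads lam"
  shows "vertical (rim_box lam ` {b - int l<..b}) \<longleftrightarrow> full_window (beads lam) (b - int l) b"
proof
  note column = rim_box_coords(2)[OF lam b]
  assume "vertical (rim_box lam ` {b - int l<..b})"
  then obtain j where j: "\<And>u. u \<in> rim_box lam ` {b - int l<..b} \<Longrightarrow> snd u = j"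
    unfolding vertical_iff_snd by blast
  have "t \<in> beads lam" if t: "b - int l < t" "t < b" for t
  proof -
    have "snd (rim_box lam t) = j" "snd (rim_box lam (t + 1)) = j"
      using t by (auto intro!: j)
    then have "int (bead_rank lam t) = int (bead_rank lam (t + 1)) + 1"
      using column[of t] column[of "t + 1"] t by linarith
    then show ?thesis using mem_beads_iff(1)[OF lam, of t] by linarith
  qed
  then show "full_window (beads lam) (b - int l) b" by (simp add: full_window_def)
next
  assume e: "full_window (beads lam) (b - int l) b"
  have rank: "int (bead_rank lam t) + t = int (bead_rank lam b) + b" if "b - int l < t" "t \<le> b" for t
  proof (rule constant_on_int_interval[OF _ that])
    fix s assume "b - int l < s" "s < b"
    then show "int (bead_rank lam s) + s = int (bead_rank lam (s + 1)) + (s + 1)"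
      using e mem_beads_iff(1)[OF lam, of s] by (simp add: full_window_def)
  qed
  have "snd u = snd (rim_box lam b)" if u: "u \<in> rim_box lam ` {b - int l<..b}" for u
  proof -
    obtain t where t: "u = rim_box lam t" "b - int l < t" "t \<le> b" using u by auto
    have "int (bead_rank lam t) - 1 + t = int (bead_rank lam b) - 1 + b"
      using rank[OF t(2,3)] by linarith
    then show ?thesis unfolding t(1) rim_box_def snd_conv by (rule arg_cong)
  qed
  then show "vertical (rim_box lam ` {b - int l<..b})"
    unfolding vertical_iff_snd by blast
qed

section \<open>Gaps, hook lengths and the JM condition\<close>

definition column_length :: "nat list \<Rightarrow> nat \<Rightarrow> nat" where
  "column_length lam j = card {i. j < row_length lam i}"

definition gap :: "nat list \<Rightarrow> nat \<Rightarrow> int" where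
  "gap lam j = int j - int (column_length lam j)"

lemma less_row_length_iff:
  assumes "is_partition lam"
  shows "j < row_length lam i \<longleftrightarrow> i < column_length lam j"
proof -
  have "finite {i. j < row_length lam i}"
    by (rule finite_subset[of _ "{..<length lam}"]) (auto simp: row_length_def split: if_splits)
  then have "{i. j < row_length lam i} = {..<card {i. j < row_length lam i}}"
    by (rule finite_down_closed_nat) (use row_length_antimono[OF assms] order_less_le_trans in blast)
  then show ?thesis unfolding column_length_def by blast
qed

text \<open>Over the integers, bead minus gap is
  \<open>(row_length lam i - j) + (column_length lam j - i) - 1\<close>. Both brackets are positive
  inside the diagram and nonpositive outside.\<close>

lemma gap_less_bead_iff:
  assumes "is_partition lam"
  shows "gap lam j < bead lam i \<longleftrightarrow> (i, j) \<in> young_diagram lam" "gap lam j \<noteq> bead lam i"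
proof -
  have "gap lam j < bead lam i" if "j < row_length lam i"
    using that less_row_length_iff[OF assms, of j i] unfolding gap_def bead_def by linarith
  moreover have "bead lam i < gap lam j" if "\<not> j < row_length lam i"
    using that less_row_length_iff[OF assms, of j i] unfolding gap_def bead_def by linarith
  ultimately show "gap lam j < bead lam i \<longleftrightarrow> (i, j) \<in> young_diagram lam" "gap lam j \<noteq> bead lam i"
    unfolding mem_young_diagram by fastforce+
qed

lemma non_beads_eq_range_gap:
  assumes lam: "is_partition lam"
  shows "- beads lam = range (gap lam)"
proof
  show "range (gap lam) \<subseteq> - beads lam"
    using gap_less_bead_iff(2)[OF lam] by (auto simp: beads_def)
  show "- beads lam \<subseteq> range (gap lam)"
  proof
    fix g assume g: "g \<in> - beads lam"
    \<comment> \<open>The column with gap \<open>g\<close> is found from its length: this is to be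
      \<open>k\<close>, which forces \<open>j = g + k\<close>.\<close>
    define k where "k = bead_rank lam g"
    define j where "j = nat (g + int k)"
    have j: "int j = g + int k" using bead_rank_ge[OF lam, of g] by (simp add: j_def k_def)
    have "j < row_length lam i \<longleftrightarrow> i < k" for i
    proof (cases "i < k")
      case True
      then have "g \<le> bead lam (k - 1)" using le_bead_iff[OF lam, of g "k - 1"] k_def by linarith
      moreover have "g \<noteq> bead lam (k - 1)" using g by (auto simp: beads_def)
      ultimately have "g < bead lam (k - 1)" by simp
      then have "int j < int (row_length lam (k - 1))" using True j unfolding bead_def by linarith
      then show ?thesis using row_length_antimono[OF lam, of i "k - 1"] True by linarith
    next
      case False
      have "bead lam k < g" using le_bead_iff[OF lam, of g k] k_def by linarith
      then have "int (row_length lam k) \<le> int j" using j unfolding bead_def by linarith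
      then show ?thesis using row_length_antimono[OF lam, of k i] False by linarith
    qed
    then have "column_length lam j = k" by (simp add: column_length_def flip: lessThan_def)
    then have "g = gap lam j" using j by (simp add: gap_def)
    then show "g \<in> range (gap lam)" by simp
  qed
qed

text \<open>The corner is counted with the row part; the column part starts strictly below
  it.\<close>

lemma hook_length_eq:
  assumes lam: "is_partition lam" and ab: "(a, b) \<in> young_diagram lam"
  shows "int (hook_length lam (a, b)) = bead lam a - gap lam b"
proof -
  have ba: "b < row_length lam a" "a < column_length lam b"
    using ab less_row_length_iff[OF lam] by (simp_all add: mem_young_diagram)
  have mem: "(x, y) \<in> young_diagram lam \<and> (x = a \<and> b \<le> y \<or> y = b \<and> a \<le> x) \<longleftrightarrow>
      x = a \<and> b \<le> y \<and> y < row_length lam a \<or> y = b \<and> a < x \<and> x < column_length lam b" for x y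
    using less_row_length_iff[OF lam, of b x] ba by (cases "x = a") (auto simp: mem_young_diagram)
  have "{(x, y). (x, y) \<in> young_diagram lam \<and> (x = a \<and> b \<le> y \<or> y = b \<and> a \<le> x)} =
      {a} \<times> {b..<row_length lam a} \<union> {a<..<column_length lam b} \<times> {b}"
    unfolding mem by auto
  then have "hook_length lam (a, b) =
      card ({a} \<times> {b..<row_length lam a} \<union> {a<..<column_length lam b} \<times> {b})"
    by (simp add: hook_length_def)
  moreover have "\<dots> = (row_length lam a - b) + (column_length lam b - Suc a)"
    by (subst card_Un_disjoint) auto
  ultimately show ?thesis using ba by (simp add: bead_def gap_def)
qed

lemma JM_partition_iff:
  assumes lam: "is_partition lam"
  shows "JM_partition l lam \<longleftrightarrow> JM_abacus (int l) (beads lam)"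
proof -
  have gap: "g \<notin> beads lam \<longleftrightarrow> (\<exists>j. g = gap lam j)" for g
    using non_beads_eq_range_gap[OF lam] by blast
  have bead: "b \<in> beads lam \<longleftrightarrow> (\<exists>i. b = bead lam i)" for b
    by (auto simp: beads_def)
  have dvd: "l dvd hook_length lam (i, j) \<longleftrightarrow> int l dvd bead lam i - gap lam j"
    if "(i, j) \<in> young_diagram lam" for i j
    using hook_length_eq[OF lam that] by (metis int_dvd_int_iff)
  have "JM_abacus (int l) (beads lam) \<longleftrightarrow>
    (\<forall>a b. gap lam b < bead lam a \<longrightarrow> int l dvd bead lam a - gap lam b \<longrightarrow>
      (\<forall>y. gap lam y < bead lam a \<longrightarrow> int l dvd bead lam a - gap lam y) \<or>
      (\<forall>x. gap lam b < bead lam x \<longrightarrow> int l dvd bead lam x - gap lam b))"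
    unfolding JM_abacus_def gap unfolding bead by blast
  also have "\<dots> \<longleftrightarrow> JM_partition l lam"
    unfolding gap_less_bead_iff(1)[OF lam] JM_partition_def using dvd lam by blast
  finally show ?thesis by simp
qed

section \<open>Adjacent hooks of opposite type\<close>

text \<open>Boxes sharing an edge have contents differing by one, which bounds the distance of the
  windows. Opposite types exclude a common interior position, which leaves the claimed values and
  one near miss on each side.\<close>

lemma adjacent_straight_rims:
  assumes "is_partition lam" "is_partition mu" and l: "3 \<le> l"
    and b: "b \<in> beads lam" "b - int l \<notin> beads lam" and mu: "beads mu = abacus_move (int l) (beads lam) b"
    and c: "c \<in> beads mu" "c - int l \<notin> beads mu"
    and opp: "full_window (beads lam) (b - int l) b \<and> empty_window (beads mu) (c - int l) c \<or>
      empty_window (beads lam) (b - int l) b \<and> full_window (beads mu) (c - int l) c"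
    and adj: "adjacent (rim_box lam ` {b - int l<..b}) (rim_box mu ` {c - int l<..c})"
  shows "c = b + int l \<or> c = b - int l"
proof -
  obtain t s where t: "b - int l < t" "t \<le> b" and s: "c - int l < s" "s \<le> c"
    and e: "share_edge (rim_box lam t) (rim_box mu s)"
    using adj by (auto simp: adjacent_def)
  have ts: "\<bar>t - s\<bar> = 1"
    using share_edge_content[OF e] rim_box_coords(3)[OF assms(1) b t]
      rim_box_coords(3)[OF assms(2) c s] by simp
  have mem: "x \<in> beads mu \<longleftrightarrow> x = b - int l \<or> x \<in> beads lam \<and> x \<noteq> b" for x
    unfolding mu by (rule mem_abacus_move)
  have disjoint: "\<not> (b - int l < x \<and> x < b \<and> c - int l < x \<and> x < c)" for x
    using opp mem[of x] unfolding full_window_def empty_window_def by auto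
  have "c \<noteq> b" using c(1) mem[of b] l by auto
  then consider "b < c" | "c < b" by linarith
  then show ?thesis
  proof cases
    case 1
    have "b + int l - 1 \<le> c" "c \<le> b + int l"
      using disjoint[of "b - 1"] 1 l t s ts by linarith+
    \<comment> \<open>Neither window could be full: that of \<open>b\<close> contains the gap
      \<open>b - 1\<close>, that of \<open>c\<close> the vacated \<open>b\<close>.\<close>
    moreover have "c \<noteq> b + int l - 1"
    proof
      assume [simp]: "c = b + int l - 1"
      have "b - 1 \<notin> beads lam" using c(2) mem[of "b - 1"] l by auto
      then have "\<not> full_window (beads lam) (b - int l) b"
        using l by (auto simp: full_window_def intro!: exI[of _ "b - 1"])
      then have "full_window (beads mu) (c - int l) c" using opp by blast
      then have "b \<in> beads mu" using l by (simp add: full_window_def)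
      then show False using mem[of b] l by simp
    qed
    ultimately show ?thesis by linarith
  next
    case 2
    have "b - int l \<le> c" "c \<le> b - int l + 1"
      using disjoint[of "c - 1"] 2 l t s ts by linarith+
    \<comment> \<open>Neither window could be empty: that of \<open>b\<close> contains the bead
      \<open>c\<close>, that of \<open>c\<close> the new bead \<open>b - int l\<close>.\<close>
    moreover have "c \<noteq> b - int l + 1"
    proof
      assume [simp]: "c = b - int l + 1"
      have "c \<in> beads lam" using c(1) mem[of c] by auto
      then have "\<not> empty_window (beads lam) (b - int l) b"
        using l by (auto simp: empty_window_def intro!: exI[of _ c])
      then have "empty_window (beads mu) (c - int l) c" using opp by blast
      then have "b - int l \<notin> beads mu" using l by (simp add: empty_window_def)
      then show False using mem[of "b - int l"] by simp
    qed
    ultimately show ?thesis by linarith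
  qed
qed

text \<open>The touching boxes have contents \<open>b\<close> and \<open>b + 1\<close>, one above
  the other because \<open>b\<close> is a bead, or \<open>b - int l + 1\<close> and
  \<open>b - int l\<close>, side by side because \<open>b - int l\<close> is a gap.\<close>

lemma adjacent_rims:
  assumes lam: "is_partition lam" and mu: "is_partition mu" and l: "0 < l"
    and b: "b \<in> beads lam" "b - int l \<notin> beads lam"
    and rank: "\<And>t. int (bead_rank mu t) = int (bead_rank lam t) - of_bool (b - int l < t \<and> t \<le> b)"
    and c: "c \<in> beads mu" "c - int l \<notin> beads mu"
    and bc: "c = b + int l \<or> c = b - int l"
  shows "adjacent (rim_box lam ` {b - int l<..b}) (rim_box mu ` {c - int l<..c})"
  using bc
proof
  assume cb: "c = b + int l"
  let ?u = "rim_box lam b" and ?v = "rim_box mu (b + 1)"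
  have r: "bead_rank lam b = Suc (bead_rank lam (b + 1))" "bead_rank mu (b + 1) = bead_rank lam (b + 1)"
    using mem_beads_iff(1)[OF lam, of b] b rank[of "b + 1"] by simp_all
  have u: "int (fst ?u) = int (bead_rank lam b) - 1" "int (snd ?u) = int (bead_rank lam b) - 1 + b"
    using rim_box_coords(1,2)[OF lam b, of b] l by simp_all
  have v: "int (fst ?v) = int (bead_rank mu (b + 1)) - 1"
    "int (snd ?v) = int (bead_rank mu (b + 1)) - 1 + (b + 1)"
    using rim_box_coords(1,2)[OF mu c, of "b + 1"] l cb by simp_all
  have "fst ?u = Suc (fst ?v)" "snd ?u = snd ?v" using u v r by linarith+
  then have "share_edge ?u ?v" by (simp add: share_edge_def case_prod_beta)
  then show ?thesis using l cb unfolding adjacent_def by fastforce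
next
  assume cb: "c = b - int l"
  let ?u = "rim_box lam (b - int l + 1)" and ?v = "rim_box mu c"
  have r: "bead_rank lam (b - int l) = bead_rank lam (b - int l + 1)"
    "bead_rank mu c = bead_rank lam (b - int l)"
    using mem_beads_iff(2)[OF lam, of "b - int l"] b rank[of c] cb by simp_all
  have u: "int (fst ?u) = int (bead_rank lam (b - int l + 1)) - 1"
    "int (snd ?u) = int (bead_rank lam (b - int l + 1)) - 1 + (b - int l + 1)"
    using rim_box_coords(1,2)[OF lam b, of "b - int l + 1"] l by simp_all
  have v: "int (fst ?v) = int (bead_rank mu c) - 1" "int (snd ?v) = int (bead_rank mu c) - 1 + c"
    using rim_box_coords(1,2)[OF mu c, of c] l by simp_all
  have "fst ?u = fst ?v" "snd ?u = Suc (snd ?v)" using u v r cb by linarith+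
  then have "share_edge ?u ?v" by (simp add: share_edge_def case_prod_beta)
  then show ?thesis using l cb unfolding adjacent_def by fastforce
qed

lemma window_abacus_move:
  assumes "b \<le> x \<or> y \<le> b" "b - l \<le> x \<or> y \<le> b - l"
  shows "full_window (abacus_move l B b) x y \<longleftrightarrow> full_window B x y"
    "empty_window (abacus_move l B b) x y \<longleftrightarrow> empty_window B x y"
  using assms unfolding full_window_def empty_window_def mem_abacus_move by force+

section \<open>From the JM condition to straight, nonadjacent hooks\<close>

lemma only_straight_hooks_if_JM_abacus:
  assumes l: "0 < l" and lam: "is_partition lam" and JM: "JM_abacus (int l) (beads lam)"
  shows "only_straight_hooks l lam"
  unfolding only_straight_hooks_def rim_hook_def
proof (intro allI impI, elim exE)
  fix R mu assume "removes_rim_hook l lam R mu"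
  then obtain b where b: "b \<in> beads lam" "b - int l \<notin> beads lam" "R = rim_box lam ` {b - int l<..b}"
    using removes_rim_hook_beads[OF lam l] by metis
  then show "horizontal R \<or> vertical R"
    using JM_abacus_straight[OF _ JM b(1,2)] l horizontal_rim_iff[OF lam b(1,2)]
      vertical_rim_iff[OF lam b(1,2)] by auto
qed

text \<open>The second window is read in \<open>mu\<close>, but the move of \<open>b\<close> alters
  no position inside it. So \<open>lam\<close> itself has two consecutive windows of opposite type
  between a gap and a bead.\<close>

lemma no_adjacent_hooks_if_JM_abacus:
  assumes l: "3 \<le> l" and lam: "is_partition lam" and JM: "JM_abacus (int l) (beads lam)"
  shows "no_adjacent_hooks l lam"
  unfolding no_adjacent_hooks_def rim_hook_def
proof (intro allI impI notI, elim exE)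
  fix R mu S nu
  assume R: "removes_rim_hook l lam R mu" and S: "removes_rim_hook l mu S nu"
    and straight: "vertical R \<and> horizontal S \<or> horizontal R \<and> vertical S" and adj: "adjacent R S"
  have l0: "0 < l" using l by simp
  have mu: "is_partition mu" using R by (simp add: removes_rim_hook_def)
  obtain b where b: "b \<in> beads lam" "b - int l \<notin> beads lam"
    and move: "beads mu = abacus_move (int l) (beads lam) b" and Rb: "R = rim_box lam ` {b - int l<..b}"
    using removes_rim_hook_beads[OF lam l0 R] by metis
  obtain c where c: "c \<in> beads mu" "c - int l \<notin> beads mu" and Sc: "S = rim_box mu ` {c - int l<..c}"
    using removes_rim_hook_beads[OF mu l0 S] by metis
  have opp: "full_window (beads lam) (b - int l) b \<and> empty_window (beads mu) (c - int l) c \<or>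
      empty_window (beads lam) (b - int l) b \<and> full_window (beads mu) (c - int l) c"
    using straight unfolding Rb Sc horizontal_rim_iff[OF lam b] vertical_rim_iff[OF lam b]
      horizontal_rim_iff[OF mu c] vertical_rim_iff[OF mu c] .
  have l2: "2 \<le> int l" using l by simp
  from adjacent_straight_rims[OF lam mu l b move c opp] adj
  have "c = b + int l \<or> c = b - int l" by (simp add: Rb Sc)
  then show False
  proof
    assume cb: "c = b + int l"
    have eq: "b - int l + 2 * int l = c" "b - int l + int l = c - int l" "c - int l = b"
      using cb by simp_all
    have "c \<in> beads lam" using c(1) cb l unfolding move mem_abacus_move by auto
    moreover have "full_window (beads mu) (c - int l) c \<longleftrightarrow> full_window (beads lam) (c - int l) c"
      "empty_window (beads mu) (c - int l) c \<longleftrightarrow> empty_window (beads lam) (c - int l) c"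
      unfolding move using cb by (simp_all add: window_abacus_move)
    ultimately show False
      using JM_abacus_not_opposite[OF l2 JM, of "b - int l"] b opp unfolding eq by blast
  next
    assume cb: "c = b - int l"
    have eq: "c - int l + 2 * int l = b" "c - int l + int l = c" "b - int l = c"
      using cb by simp_all
    have "c - int l \<notin> beads lam" using c(2) cb l unfolding move mem_abacus_move by auto
    moreover have "full_window (beads mu) (c - int l) c \<longleftrightarrow> full_window (beads lam) (c - int l) c"
      "empty_window (beads mu) (c - int l) c \<longleftrightarrow> empty_window (beads lam) (c - int l) c"
      unfolding move using cb by (simp_all add: window_abacus_move)
    ultimately show False
      using JM_abacus_not_opposite[OF l2 JM, of "c - int l"] b opp unfolding eq by blast
  qed
qed

section \<open>From generalized partitions to straight bead sets\<close>

lemma generalized_partition_step: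
  assumes "generalized_partition l lam" "straight_step l lam mu"
  shows "generalized_partition l mu"
proof -
  have "(straight_step l)\<^sup>*\<^sup>* lam nu" if "(straight_step l)\<^sup>*\<^sup>* mu nu" for nu
    using assms(2) that by (rule converse_rtranclp_into_rtranclp)
  moreover have "is_partition mu"
    using assms(2) by (auto simp: straight_step_def removes_rim_hook_def)
  ultimately show ?thesis
    using assms(1) unfolding generalized_partition_def by blast
qed

lemma straight_abaci_generalized:
  assumes l: "3 \<le> l"
  shows "straight_abaci (int l) (\<lambda>B. \<exists>lam. generalized_partition l lam \<and> B = beads lam)"
proof
  have l0: "0 < l" using l by simp
  fix B b
  assume "\<exists>lam. generalized_partition l lam \<and> B = beads lam" and b: "b \<in> B" "b - int l \<notin> B"
  then obtain lam where gen: "generalized_partition l lam" and B: "B = beads lam" by blast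
  have lam: "is_partition lam" using gen by (simp add: generalized_partition_def)
  note b = b[unfolded B]
  obtain mu where mu: "removes_rim_hook l lam (rim_box lam ` {b - int l<..b}) mu"
    "beads mu = abacus_move (int l) (beads lam) b"
    using removes_rim_hook_exists[OF lam l0 b] by metis
  have straight: "horizontal (rim_box lam ` {b - int l<..b}) \<or> vertical (rim_box lam ` {b - int l<..b})"
    using gen mu(1) unfolding generalized_partition_def only_straight_hooks_def rim_hook_def by blast
  then show "full_window B (b - int l) b \<or> empty_window B (b - int l) b"
    using horizontal_rim_iff[OF lam b] vertical_rim_iff[OF lam b] B by blast
  have "straight_step l lam mu" using straight mu(1) unfolding straight_step_def by blast
  then show "\<exists>mu. generalized_partition l mu \<and> abacus_move (int l) B b = beads mu"
    using generalized_partition_step[OF gen] mu(2) B by metis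
next
  have l0: "0 < l" using l by simp
  fix B x
  assume "\<exists>lam. generalized_partition l lam \<and> B = beads lam" and x: "x \<notin> B" "x + 2 * int l \<in> B"
  then obtain lam where gen: "generalized_partition l lam" and B: "B = beads lam" by blast
  have lam: "is_partition lam" using gen by (simp add: generalized_partition_def)
  have "\<not> (full_window B x (x + int l) \<and> empty_window B (x + int l) (x + 2 * int l) \<or>
    empty_window B x (x + int l) \<and> full_window B (x + int l) (x + 2 * int l))" (is "\<not> ?opp")
  proof
    assume opp: ?opp
    \<comment> \<open>If the middle position is a bead, it moves first and the upper bead follows;
      if it is a gap, the upper bead moves into it and then on to \<open>x\<close>. Either way the
      two hooks have the two given windows.\<close>
    define b where "b = (if x + int l \<in> B then x + int l else x + 2 * int l)"
    define c where "c = (if x + int l \<in> B then x + 2 * int l else x + int l)"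
    have b: "b \<in> beads lam" "b - int l \<notin> beads lam"
      using x unfolding B b_def by (auto simp: algebra_simps)
    obtain mu where R: "removes_rim_hook l lam (rim_box lam ` {b - int l<..b}) mu"
      and move: "beads mu = abacus_move (int l) (beads lam) b"
      and rank: "\<And>t. int (bead_rank mu t) = int (bead_rank lam t) - of_bool (b - int l < t \<and> t \<le> b)"
      using removes_rim_hook_exists[OF lam l0 b] by metis
    have mu: "is_partition mu" using R by (simp add: removes_rim_hook_def)
    have c: "c \<in> beads mu" "c - int l \<notin> beads mu"
      using x l0 unfolding move mem_abacus_move B b_def c_def by (auto simp: algebra_simps)
    obtain nu where S: "removes_rim_hook l mu (rim_box mu ` {c - int l<..c}) nu"
      using removes_rim_hook_exists[OF mu l0 c] by metis
    have bc: "c = b + int l \<or> c = b - int l" by (simp add: b_def c_def)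
    have "full_window (beads lam) (b - int l) b \<and> empty_window (beads mu) (c - int l) c \<or>
      empty_window (beads lam) (b - int l) b \<and> full_window (beads mu) (c - int l) c"
      using opp l0 by (auto simp: move window_abacus_move B b_def c_def algebra_simps)
    then have "vertical (rim_box lam ` {b - int l<..b}) \<and> horizontal (rim_box mu ` {c - int l<..c}) \<or>
      horizontal (rim_box lam ` {b - int l<..b}) \<and> vertical (rim_box mu ` {c - int l<..c})"
      unfolding horizontal_rim_iff[OF lam b] vertical_rim_iff[OF lam b]
        horizontal_rim_iff[OF mu c] vertical_rim_iff[OF mu c] .
    then show False
      using gen R S adjacent_rims[OF lam mu l0 b rank c bc]
      unfolding generalized_partition_def no_adjacent_hooks_def rim_hook_def by blast
  qed
  then show "\<not> (full_window B x (x + int l) \<and> empty_window B (x + int l) (x + 2 * int l))"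
    "\<not> (empty_window B x (x + int l) \<and> full_window B (x + int l) (x + 2 * int l))" by blast+
qed (use l in simp)

theorem theorem3p2p2p7:
  fixes l :: nat and lam :: "nat list"
  assumes "l \<ge> 3" and "is_partition lam"
  shows "JM_partition l lam \<longleftrightarrow> generalized_partition l lam"
proof
  have l0: "0 < l" using assms(1) by simp
  assume "JM_partition l lam"
  then have JM: "JM_abacus (int l) (beads lam)" using JM_partition_iff[OF assms(2)] by blast
  \<comment> \<open>The JM condition survives all removals, so conditions (1) and (2) follow from it
    at each partition reached.\<close>
  have "is_partition mu \<and> JM_abacus (int l) (beads mu)" if "(straight_step l)\<^sup>*\<^sup>* lam mu" for mu
    using that
  proof (induction rule: rtranclp_induct)
    case (step mu nu)
    then obtain R where R: "removes_rim_hook l mu R nu" by (auto simp: straight_step_def)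
    obtain b where "b \<in> beads mu" "b - int l \<notin> beads mu" "beads nu = abacus_move (int l) (beads mu) b"
      using removes_rim_hook_beads[OF _ l0 R] step.IH by metis
    then show ?case
      using JM_abacus_move[of "int l" "beads mu" b] step.IH R l0 by (simp add: removes_rim_hook_def)
  qed (use assms JM in simp)
  then have "only_straight_hooks l mu \<and> no_adjacent_hooks l mu" if "(straight_step l)\<^sup>*\<^sup>* lam mu" for mu
    using only_straight_hooks_if_JM_abacus[OF l0] no_adjacent_hooks_if_JM_abacus[OF assms(1)] that
    by blast
  then show "generalized_partition l lam"
    using assms(2) unfolding generalized_partition_def by blast
next
  assume "generalized_partition l lam"
  then have "JM_abacus (int l) (beads lam)"
    using straight_abaci.JM_abacus_if_straight[OF straight_abaci_generalized[OF assms(1)]] by blast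
  then show "JM_partition l lam" using JM_partition_iff[OF assms(2)] by blast
qed

end
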